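(* Let $f_i:\mathbb{R}^n\to\mathbb{R}$, $i=1,\dots,N$, be continuously differentiable with globally Lipschitz gradients $\nabla f_i$ (the $f_i$ need not be convex), and suppose $F(w)=\frac1N\sum_{i=1}^N f_i(w)$ is strongly convex with parameter $\alpha>0$; let $w^*$ be its minimizer. Let $N$ agents communicate over an undirected connected graph, where $\mathcal{N}_i$ is the set of neighbors of agent $i$, and consider, with $w_i,z_i\in\mathbb{R}^n$, $\xi_i\in\mathbb{R}^{2n}$ and arbitrary initial conditions, for $i=1,\dots,N$, $$\begin{bmatrix}\dot w_i\\ \dot z_i\end{bmatrix}=\begin{bmatrix}z_i\\ -2\sqrt{\alpha}\,z_i-\nabla f_i(w_i)\end{bmatrix}+k_{\mathrm P}\sum_{j\in\mathcal{N}_i}\left(\begin{bmatrix}w_j\\ z_j\end{bmatrix}-\begin{bmatrix}w_i\\ z_i\end{bmatrix}\right)+k_{\mathrm I}\sum_{j\in\mathcal{N}_i}(\xi_j-\xi_i),$$ $$\dot\xi_i=-k_{\mathrm I}\sum_{j\in\mathcal{N}_i}\left(\begin{bmatrix}w_j\\ z_j\end{bmatrix}-\begin{bmatrix}w_i\\ z_i\end{bmatrix}\right).$$ Then, for every $k_{\mathrm I}>0$ and all sufficiently large $k_{\mathrm P}$ (depending on $k_{\mathrm I}$), the states $w_i,z_i$ converge to the equilibrium $[w^*;0]$ of the centralized heavy-ball method $\dot{\bar w}=\bar z$, $\dot{\bar z}=-2\sqrt{\alpha}\,\bar z-\nabla F(\bar w)$, i.e. $w_i(t)\to w^*$ and $z_i(t)\to0$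 as $t\to\infty$ for all $i$. Moreover, the convergence rate of the algorithm can be made arbitrarily close to $\sqrt{\alpha}/2$ with $k_{\mathrm P}=k_{\mathrm I}^{3/2}$ and sufficiently large $k_{\mathrm I}$; that is, for every $\upsilon\in(0,\sqrt{\alpha}/2)$ there is $\bar k>0$ such that, for all $k_{\mathrm I}>\bar k$ and $k_{\mathrm P}=k_{\mathrm I}^{3/2}$, every $[w_i(t);z_i(t)]$ converges to $[w^*;0]$ exponentially fast at least with the rate $\sqrt{\alpha}/2-\upsilon$.
   Context: $[a;b]$ denotes vertical stacking. $F:\mathbb{R}^n\to\mathbb{R}$ is strongly convex with parameter $\alpha$ if $(\nabla F(w)-\nabla F(w_0))^\top(w-w_0)\ge\alpha|w-w_0|^2$ for all $w,w_0$, where $|\cdot|$ is the Euclidean norm. A function $p(t)$ converges to $p^*$ exponentially fast at least with the rate $r>0$ if there is a constant $C$ with $|p(t)-p^*|\le Ce^{-rt}$ for all $t\ge0$. *)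

theory Defs
  imports "HOL-Analysis.Analysis"
begin

definition gradient :: "(real^'n \<Rightarrow> real) \<Rightarrow> real^'n \<Rightarrow> real^'n" where
  "gradient f x = (THE D. GDERIV f x :> D)"

lemma gradient_eqI:
  assumes "GDERIV f x :> D"
  shows "gradient f x = D"
  unfolding gradient_def
proof (rule the_equality)
  fix D'
  assume "GDERIV f x :> D'"
  with assms have "(\<lambda>h. h \<bullet> D') = (\<lambda>h. h \<bullet> D)"
    unfolding gderiv_def by (rule has_derivative_unique[rotated])
  then show "D' = D"
    by (metis inner_commute vector_eq_rdot)
qed (fact assms)

lemma GDERIV_gradient:
  fixes f :: "real^'n \<Rightarrow> real"
  assumes "f differentiable (at x)"
  shows "GDERIV f x :> gradient f x"
proof -
  obtain f' where f': "(f has_derivative f') (at x)"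
    using assms by (auto simp: differentiable_def)
  then interpret bounded_linear f' by (rule has_derivative_bounded_linear)
  have "f' h = h \<bullet> adjoint f' 1" for h
    using adjoint_works[OF linear_axioms, of h 1] by simp
  then have "f' = (\<lambda>h. h \<bullet> adjoint f' 1)" ..
  with f' have "GDERIV f x :> adjoint f' 1"
    unfolding gderiv_def by simp
  then show ?thesis
    using gradient_eqI by metis
qed

definition continuously_differentiable :: "(real^'n \<Rightarrow> real) \<Rightarrow> bool" where
  "continuously_differentiable f \<longleftrightarrow>
     (\<forall>x. f differentiable (at x)) \<and> continuous_on UNIV (gradient f)"

definition strongly_convex :: "real \<Rightarrow> (real^'n \<Rightarrow> real) \<Rightarrow> bool" where
  "strongly_convex \<alpha> F \<longleftrightarrow>
     (\<forall>x. F differentiable (at x)) \<and>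
     (\<forall>w w0. (gradient F w - gradient F w0) \<bullet> (w - w0) \<ge> \<alpha> * (norm (w - w0))\<^sup>2)"

definition average :: "('v::finite \<Rightarrow> real^'n \<Rightarrow> real) \<Rightarrow> real^'n \<Rightarrow> real" where
  "average f w = (1 / real CARD('v)) * (\<Sum>i\<in>UNIV. f i w)"

text \<open>A simple undirected graph on the vertex type is given by its symmetric
  irreflexive adjacency relation.\<close>

definition connected_graph :: "('v \<times> 'v) set \<Rightarrow> bool" where
  "connected_graph E \<longleftrightarrow> sym E \<and> irrefl E \<and> (\<forall>i j. (i, j) \<in> E\<^sup>*)"

definition neighbors :: "('v \<times> 'v) set \<Rightarrow> 'v \<Rightarrow> 'v set" where
  "neighbors E i = {j. (i, j) \<in> E}"

text \<open>Vertical stacking is rendered by pairs; the norm on the product type is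
  \<open>norm (a, b) = sqrt ((norm a)\<^sup>2 + (norm b)\<^sup>2)\<close>, i.e. the Euclidean norm of the stacked vector.\<close>

definition heavy_ball_field ::
    "real \<Rightarrow> (real^'n \<Rightarrow> real) \<Rightarrow> (real^'n) \<times> (real^'n) \<Rightarrow> (real^'n) \<times> (real^'n)" where
  "heavy_ball_field \<alpha> F = (\<lambda>(w, z). (z, - (2 * sqrt \<alpha>) *\<^sub>R z - gradient F w))"

text \<open>Solutions live on \<open>{0..}\<close> (one-sided derivative at time 0); initial values are unconstrained.\<close>

definition distributed_heavy_ball_solution ::
    "real \<Rightarrow> ('v::finite \<times> 'v) set \<Rightarrow> ('v \<Rightarrow> real^'n \<Rightarrow> real) \<Rightarrow> real \<Rightarrow> real \<Rightarrow>
     ('v \<Rightarrow> real \<Rightarrow> real^'n) \<Rightarrow> ('v \<Rightarrow> real \<Rightarrow> real^'n) \<Rightarrow>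
     ('v \<Rightarrow> real \<Rightarrow> (real^'n) \<times> (real^'n)) \<Rightarrow> bool" where
  "distributed_heavy_ball_solution \<alpha> E f kP kI w z \<xi> \<longleftrightarrow>
     (\<forall>i. \<forall>t\<ge>0.
        ((\<lambda>s. (w i s, z i s)) has_vector_derivative
           heavy_ball_field \<alpha> (f i) (w i t, z i t)
           + kP *\<^sub>R (\<Sum>j\<in>neighbors E i. (w j t, z j t) - (w i t, z i t))
           + kI *\<^sub>R (\<Sum>j\<in>neighbors E i. \<xi> j t - \<xi> i t)) (at t within {0..}) \<and>
        (\<xi> i has_vector_derivative
           - kI *\<^sub>R (\<Sum>j\<in>neighbors E i. (w j t, z j t) - (w i t, z i t))) (at t within {0..}))"

definition converges_exponentially ::
    "(real \<Rightarrow> 'a::real_normed_vector) \<Rightarrow> 'a \<Rightarrow> real \<Rightarrow> bool" where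
  "converges_exponentially p p_star r \<longleftrightarrow>
     r > 0 \<and> (\<exists>C. \<forall>t\<ge>0. norm (p t - p_star) \<le> C * exp (- r * t))"

end

theory Submission
  imports Defs
begin

text \<open>
  Write \<open>x\<close> for the vector of all pairs \<open>(w\<^sub>i, z\<^sub>i)\<close>, \<open>y\<close> for the vector of all \<open>\<xi>\<^sub>i\<close>, \<open>p\<close> for the
  proportional and \<open>k\<close> for the integral gain, and \<open>L\<close> for the graph Laplacian. The algorithm is
  \<open>x' = \<Phi> x - p L x - k L y\<close>, \<open>y' = k L x\<close>, where \<open>\<Phi>\<close> applies the heavy-ball field of each agent. The
  fields need not vanish at \<open>x\<^sub>0 = (w\<^sup>*, 0)\<^sub>i\<close>, but their mean does, and on a connected graph \<open>L\<close> maps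
  onto the vectors of mean zero (\<open>laplacian_solvable\<close>). So some \<open>\<eta>\<close> satisfies
  \<open>k L \<eta> = \<Phi> x\<^sub>0\<close>, and \<open>(x\<^sub>0, \<eta>)\<close> is an equilibrium. What converges is measured by the mean \<open>m\<close> of
  \<open>x\<close> and by the deviations \<open>e\<close> of \<open>x\<close> and \<open>h\<close> of \<open>y - \<eta>\<close> from their means. The Lyapunov function
  is a sum of two parts.

  The mean obeys the centralized heavy-ball equation, except that the gradient is evaluated at the
  agents' positions instead of their mean, an error of size \<open>O(\<bar>e\<bar>)\<close>. Put \<open>s = sqrt \<alpha>\<close>. For the
  centralized equation with state \<open>(a, b)\<close> and \<open>F = average f\<close>, the energy
  \<open>V = F a - F w\<^sup>* + \<bar>s (a - w\<^sup>*) + b\<bar>\<^sup>2 / 2\<close> satisfies \<open>V' \<le> - s V\<close>; with the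
  error it satisfies \<open>V' \<le> - (s - \<upsilon>) V + O(\<bar>e\<bar>\<^sup>2)\<close> for each fixed \<open>\<upsilon> > 0\<close>
  (\<open>heavy_ball_energy_dissipation\<close>).

  For the deviations, the network damps \<open>\<bar>e\<bar>\<^sup>2 / 2 + \<bar>h\<bar>\<^sup>2 / 2\<close> only through \<open>e\<close>, since the couplings between
  \<open>e\<close> and \<open>h\<close> cancel. Adding the cross term \<open>k / (4 p) (e \<bullet> h)\<close> makes \<open>h\<close> decay as well, with
  coefficient proportional to \<open>k\<^sup>2 / p\<close>, while \<open>e\<close> has coefficient proportional to \<open>p\<close> and the
  forcing by \<open>\<Phi> x - \<Phi> x\<^sub>0\<close> enters with a factor \<open>O(1 / p)\<close> (\<open>disagreement_dissipation\<close>).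

  For large \<open>p \<ge> k\<close> the terms that couple the two parts are absorbed, and the sum \<open>W\<close> satisfies
  \<open>W' \<le> - \<rho> W\<close> for every \<open>\<rho>\<close> with \<open>0 \<le> \<rho> \<le> min (s - 2 \<upsilon>) (c k\<^sup>2 / p)\<close>
  (\<open>total_energy_dissipation\<close>). Up to a factor \<open>W\<close> dominates \<open>\<bar>x - x\<^sub>0\<bar>\<^sup>2\<close>, so \<open>x\<close>
  converges at the rate \<open>\<rho> / 2\<close>. For fixed \<open>k\<close> this rate can be taken positive for all large \<open>p\<close>, hence
  convergence. For \<open>p = k powr (3/2)\<close> one has \<open>k\<^sup>2 / p = sqrt k\<close>, which exceeds every bound as \<open>k\<close>
  grows, so that the first entry of the minimum decides, and the rate is \<open>s / 2 - \<upsilon>\<close>.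
\<close>

section \<open>Elementary inequalities and derivatives\<close>

lemma power2_norm_add_le: "(norm (a + b))\<^sup>2 \<le> 2 * (norm a)\<^sup>2 + 2 * (norm (b :: 'a::real_inner))\<^sup>2"
proof -
  have "(norm (a + b))\<^sup>2 + (norm (a - b))\<^sup>2 = 2 * (norm a)\<^sup>2 + 2 * (norm b)\<^sup>2"
    by (simp add: power2_norm_eq_inner inner_add_left inner_add_right inner_diff_left inner_diff_right)
  then show ?thesis
    by (smt (verit) zero_le_power2)
qed

text \<open>Young's inequality. The weight decides which of two coupled quantities has to absorb the
  coupling.\<close>
lemma inner_le_weighted_squares:
  fixes x y :: "'a::real_inner"
  assumes "c > 0"
  shows "x \<bullet> y \<le> c * (norm x)\<^sup>2 + (norm y)\<^sup>2 / (4 * c)"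
proof -
  have "0 \<le> (norm ((2 * c) *\<^sub>R x - y))\<^sup>2" by simp
  also have "\<dots> = 4 * c * (c * (norm x)\<^sup>2 + (norm y)\<^sup>2 / (4 * c) - x \<bullet> y)"
    using assms by (simp add: power2_norm_eq_inner inner_diff_left inner_diff_right inner_commute
        algebra_simps)
  finally show ?thesis
    using assms by (simp add: zero_le_mult_iff)
qed

lemma norm_fst_snd_le: "norm (fst p) \<le> norm p" "norm (snd p) \<le> norm p"
  for p :: "'a::real_normed_vector \<times> 'b::real_normed_vector"
  using norm_fst_le[of "fst p" "snd p"] norm_snd_le[of "snd p" "fst p"] by simp_all

lemma has_real_derivative_inner:
  fixes f g :: "real \<Rightarrow> 'a::real_inner"
  assumes "(f has_vector_derivative f') (at t within S)" and "(g has_vector_derivative g') (at t within S)"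
  shows "((\<lambda>t. f t \<bullet> g t) has_real_derivative f' \<bullet> g t + f t \<bullet> g') (at t within S)"
  using bounded_bilinear.has_vector_derivative[OF bounded_bilinear_inner assms]
  by (simp add: has_real_derivative_iff_has_vector_derivative add.commute)

text \<open>Lets the differential equations of the agents be read as one equation for the stacked state.\<close>
lemma has_vector_derivative_vec:
  fixes x :: "real \<Rightarrow> 'a::real_normed_vector^'v"
  assumes "\<And>i. ((\<lambda>t. x t $ i) has_vector_derivative x' $ i) (at t within S)"
  shows "(x has_vector_derivative x') (at t within S)"
  unfolding has_vector_derivative_def has_derivative_within
proof
  show "bounded_linear (\<lambda>h. h *\<^sub>R x')" by (rule bounded_linear_scaleR_left)
  show "((\<lambda>y. (1 / norm (y - t)) *\<^sub>R (x y - (x t + (y - t) *\<^sub>R x'))) \<longlongrightarrow> 0) (at t within S)"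
    by (rule vec_tendstoI)
       (use assms in \<open>simp add: has_vector_derivative_def has_derivative_within\<close>)
qed

text \<open>By the hypothesis \<open>W t * exp (\<rho> * t)\<close> is nonincreasing. Derivatives are one-sided at \<open>0\<close>, where
  continuity is enough for this argument.\<close>
lemma exponential_decay:
  fixes W W' :: "real \<Rightarrow> real"
  assumes deriv: "\<And>t. t \<ge> 0 \<Longrightarrow> (W has_real_derivative W' t) (at t within {0..})"
    and le: "\<And>t. t \<ge> 0 \<Longrightarrow> W' t \<le> - \<rho> * W t" and "t \<ge> 0"
  shows "W t \<le> W 0 * exp (- \<rho> * t)"
proof -
  define g where "g s = W s * exp (\<rho> * s)" for s
  have g': "(g has_real_derivative (W' s + \<rho> * W s) * exp (\<rho> * s)) (at s within {0..})"
    if "s \<ge> 0" for s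
    unfolding g_def using deriv[OF that]
    by (auto intro!: derivative_eq_intros simp: algebra_simps)
  have "g t \<le> g 0"
  proof (rule DERIV_nonpos_imp_decreasing_open[OF \<open>t \<ge> 0\<close>])
    fix s :: real assume s: "0 < s" "s < t"
    then have "at s within {0..} = at s" by (intro at_within_interior) simp
    with g'[of s] s have "DERIV g s :> (W' s + \<rho> * W s) * exp (\<rho> * s)" by simp
    moreover have "(W' s + \<rho> * W s) * exp (\<rho> * s) \<le> 0"
      using le[of s] s by (simp add: mult_le_0_iff)
    ultimately show "\<exists>y. DERIV g s :> y \<and> y \<le> 0" by blast
  next
    have "continuous_on {0..} g"
      by (rule DERIV_continuous_on, rule g') simp
    then show "continuous_on {0..t} g" by (rule continuous_on_subset) auto
  qed
  then have "W t * exp (\<rho> * t) \<le> W 0" by (simp add: g_def)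
  then show ?thesis by (simp add: exp_minus field_simps)
qed

section \<open>Averages and the graph Laplacian\<close>

definition mean :: "'a::real_vector^'v \<Rightarrow> 'a" where
  "mean x = (1 / real CARD('v)) *\<^sub>R (\<Sum>i\<in>UNIV. x $ i)"

definition deviation :: "'a::real_vector^'v \<Rightarrow> 'a^'v" where
  "deviation x = (\<chi> i. x $ i - mean x)"

definition laplacian :: "('v::finite \<times> 'v) set \<Rightarrow> 'a::real_vector^'v \<Rightarrow> 'a^'v" where
  "laplacian E x = (\<chi> i. \<Sum>j\<in>neighbors E i. x $ i - x $ j)"

lemma laplacian_nth: "laplacian E x $ i = - (\<Sum>j\<in>neighbors E i. x $ j - x $ i)"
  by (simp add: laplacian_def flip: sum_negf)

lemma linear_mean: "linear (mean :: 'a::real_vector^'v \<Rightarrow> 'a)"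
  by (rule linearI) (simp_all add: mean_def sum.distrib scaleR_add_right flip: scaleR_sum_right)

lemma linear_deviation: "linear (deviation :: 'a::real_vector^'v \<Rightarrow> 'a^'v)"
  by (rule linearI)
     (simp_all add: deviation_def vec_eq_iff linear_add[OF linear_mean] linear_cmul[OF linear_mean]
        scaleR_diff_right)

lemma linear_laplacian: "linear (laplacian E :: 'a::real_vector^'v \<Rightarrow> 'a^'v)"
proof (rule linearI)
  fix x y :: "'a^'v" and c :: real
  show "laplacian E (x + y) = laplacian E x + laplacian E y"
    by (simp add: laplacian_def vec_eq_iff flip: sum.distrib) (simp add: algebra_simps)
  show "laplacian E (c *\<^sub>R x) = c *\<^sub>R laplacian E x"
    by (simp add: laplacian_def vec_eq_iff scaleR_sum_right scaleR_diff_right)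
qed

lemma mean_const [simp]: "mean ((\<chi> i. c) :: 'a::real_vector^'v) = c"
  by (simp add: mean_def sum_constant_scaleR)

lemma mean_deviation [simp]: "mean (deviation x) = 0"
  by (simp add: mean_def deviation_def sum_subtractf sum_constant_scaleR)

lemma inner_const_vec:
  "x \<bullet> ((\<chi> i. c) :: 'a::real_inner^'v) = real CARD('v) * (mean x \<bullet> c)"
  by (simp add: inner_vec_def mean_def inner_sum_left)

lemma deviation_eq: "deviation x = x - (\<chi> i. mean x)"
  by (simp add: deviation_def vec_eq_iff)

lemma inner_deviation_right: "deviation x \<bullet> deviation y = deviation x \<bullet> y"
  by (simp add: deviation_eq[of y] inner_diff_right inner_const_vec)

text \<open>Vectors of mean zero are orthogonal to the constant ones, so \<open>deviation\<close> is an orthogonal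
  projection.\<close>
lemma norm_deviation_le: "norm (deviation x) \<le> norm (x :: 'a::real_inner^'v)"
proof -
  have "(norm (deviation x))\<^sup>2 \<le> norm (deviation x) * norm x"
    by (metis inner_deviation_right norm_cauchy_schwarz power2_norm_eq_inner)
  then show ?thesis
    by (cases "norm (deviation x) = 0") (auto simp: power2_eq_square)
qed

lemma norm_mean_le:
  fixes x :: "'a::real_normed_vector^'v"
  assumes "\<And>i. norm (x $ i) \<le> B"
  shows "norm (mean x) \<le> B"
proof -
  have "norm (\<Sum>i\<in>UNIV. x $ i) \<le> real CARD('v) * B"
    by (rule sum_norm_bound) (rule assms)
  then show ?thesis by (simp add: mean_def divide_le_eq mult.commute)
qed

text \<open>Pythagoras: consensus errors and the error of the mean can be estimated separately.\<close>
lemma norm_sq_deviation_mean: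
  "(norm (x - (\<chi> i. c)))\<^sup>2 = (norm (deviation x))\<^sup>2 + real CARD('v) * (norm (mean x - c))\<^sup>2"
  for x :: "'a::real_inner^'v"
proof -
  define d :: "'a^'v" where "d = (\<chi> i. mean x - c)"
  have split: "x - (\<chi> i. c) = deviation x + d"
    by (simp add: deviation_def d_def vec_eq_iff)
  have "deviation x \<bullet> d = 0" and norm_d: "d \<bullet> d = real CARD('v) * (norm (mean x - c))\<^sup>2"
    by (simp_all only: d_def inner_const_vec mean_deviation mean_const power2_norm_eq_inner) simp
  then have "d \<bullet> deviation x = 0" by (simp add: inner_commute)
  then show ?thesis
    unfolding split using \<open>deviation x \<bullet> d = 0\<close> norm_d
    by (simp add: power2_norm_eq_inner inner_add_left inner_add_right)
qed

lemma sum_neighbors_swap: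
  assumes "sym E"
  shows "(\<Sum>i\<in>UNIV. \<Sum>j\<in>neighbors E i. g i j) = (\<Sum>i\<in>(UNIV::'v::finite set). \<Sum>j\<in>neighbors E i. g j i)"
proof -
  have "(i, j) \<in> E \<longleftrightarrow> (j, i) \<in> E" for i j
    using assms by (meson symD)
  then show ?thesis
    using sum.swap_restrict[of UNIV UNIV g "\<lambda>i j. (i, j) \<in> E"] by (simp add: neighbors_def)
qed

text \<open>The Laplacian form is half the Dirichlet form, since each edge occurs once in each direction.
  Symmetry, positivity and the vanishing of the mean of \<open>laplacian E x\<close> are all read off from
  this formula.\<close>
lemma inner_laplacian:
  fixes x y :: "'a::real_inner^'v"
  assumes "sym E"
  shows "laplacian E x \<bullet> y = (\<Sum>i\<in>UNIV. \<Sum>j\<in>neighbors E i. (x $ i - x $ j) \<bullet> (y $ i - y $ j)) / 2"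
proof -
  have A: "laplacian E x \<bullet> y = (\<Sum>i\<in>UNIV. \<Sum>j\<in>neighbors E i. (x $ i - x $ j) \<bullet> y $ i)"
    by (simp add: laplacian_def inner_vec_def inner_sum_left)
  also have "\<dots> = (\<Sum>i\<in>UNIV. \<Sum>j\<in>neighbors E i. (x $ j - x $ i) \<bullet> y $ j)"
    by (rule sum_neighbors_swap[OF assms])
  finally have "2 * (laplacian E x \<bullet> y)
      = (\<Sum>i\<in>UNIV. \<Sum>j\<in>neighbors E i. (x $ i - x $ j) \<bullet> y $ i + (x $ j - x $ i) \<bullet> y $ j)"
    using A by (simp add: sum.distrib)
  also have "\<dots> = (\<Sum>i\<in>UNIV. \<Sum>j\<in>neighbors E i. (x $ i - x $ j) \<bullet> (y $ i - y $ j))"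
    by (intro sum.cong refl) (simp add: algebra_simps inner_diff_left inner_diff_right)
  finally show ?thesis by simp
qed

lemma laplacian_self_adjoint:
  assumes "sym E"
  shows "laplacian E x \<bullet> y = x \<bullet> laplacian E (y :: 'a::real_inner^'v)"
  using inner_laplacian[OF assms, of x y] inner_laplacian[OF assms, of y x]
  by (simp add: inner_commute)

lemma laplacian_nonneg:
  assumes "sym E"
  shows "laplacian E x \<bullet> (x :: 'a::real_inner^'v) \<ge> 0"
  by (simp add: inner_laplacian[OF assms] sum_nonneg)

lemma mean_laplacian:
  assumes "sym E"
  shows "mean (laplacian E x :: 'a::real_inner^'v) = 0"
proof -
  have "real CARD('v) * (mean (laplacian E x) \<bullet> c) = 0" for c
    unfolding inner_const_vec[symmetric] by (simp add: inner_laplacian[OF assms])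
  from this[of "mean (laplacian E x)"] show ?thesis by simp
qed

lemma laplacian_deviation: "laplacian E (deviation x) = laplacian E x"
  by (simp add: laplacian_def deviation_def)

lemma deviation_laplacian:
  assumes "sym E"
  shows "deviation (laplacian E x) = laplacian E (x :: 'a::real_inner^'v)"
  by (simp add: deviation_def mean_laplacian[OF assms] vec_eq_iff)

lemma edge_le_laplacian:
  fixes x :: "'a::real_inner^'v"
  assumes "sym E" and "(i, j) \<in> E"
  shows "(norm (x $ i - x $ j))\<^sup>2 \<le> 2 * (laplacian E x \<bullet> x)"
proof -
  have "(norm (x $ i - x $ j))\<^sup>2 \<le> (\<Sum>j\<in>neighbors E i. (norm (x $ i - x $ j))\<^sup>2)"
    using assms by (intro member_le_sum[where f="\<lambda>j. (norm (x $ i - x $ j))\<^sup>2"]) (auto simp: neighbors_def)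
  also have "\<dots> \<le> (\<Sum>i\<in>UNIV. \<Sum>j\<in>neighbors E i. (norm (x $ i - x $ j))\<^sup>2)"
    by (intro member_le_sum[where f="\<lambda>i. \<Sum>j\<in>neighbors E i. (norm (x $ i - x $ j))\<^sup>2"]) (auto intro: sum_nonneg)
  also have "\<dots> = 2 * (laplacian E x \<bullet> x)"
    by (simp add: inner_laplacian[OF assms(1)] power2_norm_eq_inner)
  finally show ?thesis .
qed

text \<open>Going along a path, the difference between its ends is a sum of differences along edges. The
  constant grows exponentially with the length of the path, but does not depend on \<open>x\<close>.\<close>
lemma pair_le_laplacian:
  fixes E :: "('v::finite \<times> 'v) set"
  assumes "sym E" and "(i, j) \<in> E\<^sup>*"
  shows "\<exists>C\<ge>0. \<forall>x :: 'a::real_inner^'v. (norm (x $ i - x $ j))\<^sup>2 \<le> C * (laplacian E x \<bullet> x)"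
  using assms(2)
proof (induction rule: rtrancl_induct)
  case base
  show ?case by (auto intro!: exI[of _ 0])
next
  case (step j k)
  then obtain C where C: "C \<ge> 0"
    "\<And>x :: 'a^'v. (norm (x $ i - x $ j))\<^sup>2 \<le> C * (laplacian E x \<bullet> x)" by blast
  have "(norm (x $ i - x $ k))\<^sup>2 \<le> (2 * C + 4) * (laplacian E x \<bullet> x)" for x :: "'a^'v"
    using power2_norm_add_le[of "x $ i - x $ j" "x $ j - x $ k"] C(2)[of x]
      edge_le_laplacian[OF assms(1) step(2), of x] by (simp add: algebra_simps)
  then show ?case using C(1) by (intro exI[of _ "2 * C + 4"]) auto
qed

text \<open>The Poincare inequality of a connected graph; the best such \<open>l\<close> is the algebraic connectivity.
  The mean minimizes the sum of squared distances to a point, so comparing all entries with the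
  entry at one vertex overestimates the deviation.\<close>
lemma laplacian_coercive:
  fixes E :: "('v::finite \<times> 'v) set"
  assumes "connected_graph E"
  obtains l where "l > 0"
    "\<And>x :: 'a::real_inner^'v. l * (norm (deviation x))\<^sup>2 \<le> laplacian E x \<bullet> x"
proof -
  have sym: "sym E" and conn: "\<And>i j. (i, j) \<in> E\<^sup>*"
    using assms by (auto simp: connected_graph_def)
  obtain C where C: "\<And>i j. C i j \<ge> 0"
    "\<And>i j (x :: 'a^'v). (norm (x $ i - x $ j))\<^sup>2 \<le> C i j * (laplacian E x \<bullet> x)"
    using pair_le_laplacian[OF sym conn] by metis
  define D where "D = (\<Sum>i\<in>UNIV. \<Sum>j\<in>UNIV. C i j) + 1"
  have Dpos: "D > 0" unfolding D_def using C(1) by (smt (verit) sum_nonneg)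
  have "(norm (deviation x))\<^sup>2 \<le> D * (laplacian E x \<bullet> x)" for x :: "'a^'v"
  proof -
    \<comment> \<open>Any fixed vertex serves as the reference point.\<close>
    define j :: 'v where "j = undefined"
    have L: "laplacian E x \<bullet> x \<ge> 0" by (rule laplacian_nonneg[OF sym])
    have "(norm (deviation x))\<^sup>2 \<le> (norm (x - (\<chi> i. x $ j)))\<^sup>2"
      by (simp add: norm_sq_deviation_mean)
    also have "\<dots> = (\<Sum>i\<in>UNIV. (norm (x $ i - x $ j))\<^sup>2)"
      by (simp add: power2_norm_eq_inner inner_vec_def)
    also have "\<dots> \<le> (\<Sum>i\<in>UNIV. C i j * (laplacian E x \<bullet> x))"
      by (intro sum_mono C)
    also have "\<dots> = (\<Sum>i\<in>UNIV. C i j) * (laplacian E x \<bullet> x)"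
      by (simp add: sum_distrib_right)
    also have "\<dots> \<le> D * (laplacian E x \<bullet> x)"
    proof (rule mult_right_mono[OF _ L])
      have "(\<Sum>i\<in>UNIV. C i j) \<le> (\<Sum>i\<in>UNIV. \<Sum>j\<in>UNIV. C i j)"
        by (intro sum_mono member_le_sum[where f="C _"]) (auto simp: C)
      then show "(\<Sum>i\<in>UNIV. C i j) \<le> D" by (simp add: D_def)
    qed
    finally show ?thesis .
  qed
  then show ?thesis
    using Dpos by (intro that[of "1 / D"]) (simp_all add: pos_divide_le_eq mult.commute)
qed

text \<open>The kernel of the Laplacian consists of the constant vectors. Adding the mean as a constant vector
  makes the map injective, hence surjective, and changes nothing on vectors of mean zero.\<close>
lemma laplacian_solvable:
  fixes b :: "'a::euclidean_space^'v"
  assumes "connected_graph E" and "mean b = 0"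
  obtains \<xi> where "laplacian E \<xi> = b"
proof -
  have sym: "sym E" using assms by (auto simp: connected_graph_def)
  obtain l where l: "l > 0" "\<And>x :: 'a^'v. l * (norm (deviation x))\<^sup>2 \<le> laplacian E x \<bullet> x"
    using laplacian_coercive[OF assms(1)] by blast
  define T :: "'a^'v \<Rightarrow> 'a^'v" where "T x = laplacian E x + (\<chi> i. mean x)" for x
  have mean_T: "mean (T x) = mean x" for x
    by (simp add: T_def linear_add[OF linear_mean] mean_laplacian[OF sym])
  have "linear T"
    by (rule linearI)
       (simp_all add: T_def vec_eq_iff linear_add[OF linear_mean] linear_cmul[OF linear_mean]
         linear_add[OF linear_laplacian] linear_cmul[OF linear_laplacian] scaleR_add_right)
  moreover have "inj T"
    unfolding linear_injective_0[OF \<open>linear T\<close>]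
  proof (intro allI impI)
    fix x assume "T x = 0"
    then have m: "mean x = 0"
      using mean_T[of x] linear_0[OF linear_mean] by metis
    with \<open>T x = 0\<close> have "laplacian E x = 0" by (simp add: T_def vec_eq_iff)
    with l(2)[of x] l(1) have "(norm (deviation x))\<^sup>2 \<le> 0"
      by (simp add: mult_le_0_iff)
    then show "x = 0" using m by (simp add: deviation_def vec_eq_iff)
  qed
  ultimately have "surj T" by (rule linear_injective_imp_surjective) simp
  then obtain \<xi> where "T \<xi> = b" by (metis surjD)
  moreover from this have "mean \<xi> = 0" using mean_T assms(2) by metis
  ultimately show ?thesis by (intro that[of \<xi>]) (simp add: T_def vec_eq_iff)
qed

section \<open>Strong convexity and the heavy-ball energy\<close>

text \<open>Passes from monotonicity of the gradient to function values: along the segment from \<open>x\<close> to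
  \<open>y\<close>, the difference \<open>g\<close> between \<open>F\<close> and the quadratic lower model has a nonnegative
  derivative.\<close>
lemma strongly_convex_lower_bound:
  fixes F :: "real^'n \<Rightarrow> real"
  assumes "strongly_convex \<alpha> F"
  shows "F x + gradient F x \<bullet> (y - x) + \<alpha> / 2 * (norm (y - x))\<^sup>2 \<le> F y"
proof -
  define d where "d = y - x"
  define g where "g t = F (x + t *\<^sub>R d) - t * (gradient F x \<bullet> d) - \<alpha> / 2 * t\<^sup>2 * (norm d)\<^sup>2" for t :: real
  define g' where "g' t = gradient F (x + t *\<^sub>R d) \<bullet> d - gradient F x \<bullet> d - \<alpha> * t * (norm d)\<^sup>2" for t
  have deriv: "(g has_real_derivative g' t) (at t)" for t
  proof -
    have "GDERIV F (x + t *\<^sub>R d) :> gradient F (x + t *\<^sub>R d)"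
      using assms by (intro GDERIV_gradient) (simp add: strongly_convex_def)
    then have "((\<lambda>t. F (x + t *\<^sub>R d)) has_derivative (\<lambda>h. (h *\<^sub>R d) \<bullet> gradient F (x + t *\<^sub>R d))) (at t)"
      unfolding gderiv_def
      by (rule has_derivative_compose[where g=F, rotated]) (auto intro!: derivative_eq_intros)
    then have "((\<lambda>t. F (x + t *\<^sub>R d)) has_real_derivative gradient F (x + t *\<^sub>R d) \<bullet> d) (at t)"
      by (simp add: has_field_derivative_def inner_commute mult_commute_abs)
    then show ?thesis
      unfolding g_def g'_def by (auto intro!: derivative_eq_intros)
  qed
  have "g' t \<ge> 0" if "t \<ge> 0" for t
  proof (cases "t = 0")
    case False
    have "\<alpha> * (norm (t *\<^sub>R d))\<^sup>2 \<le> (gradient F (x + t *\<^sub>R d) - gradient F x) \<bullet> (t *\<^sub>R d)"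
      using assms unfolding strongly_convex_def by (metis add_diff_cancel_left')
    then have "t * (\<alpha> * t * (norm d)\<^sup>2) \<le> t * ((gradient F (x + t *\<^sub>R d) - gradient F x) \<bullet> d)"
      by (simp add: power_mult_distrib power2_eq_square mult_ac)
    then show ?thesis
      using False that by (simp add: g'_def inner_diff_left)
  qed (simp add: g'_def)
  then have "g 0 \<le> g 1"
    using deriv by (intro DERIV_nonneg_imp_nondecreasing[of 0 1 g]) auto
  then show ?thesis by (simp add: g_def d_def)
qed

lemma minimizer_imp_gradient_zero:
  fixes F :: "real^'n \<Rightarrow> real"
  assumes "F differentiable (at x)" and "\<And>y. F x \<le> F y"
  shows "gradient F x = 0"
proof -
  have "(F has_derivative (\<lambda>h. h \<bullet> gradient F x)) (at x)"
    using GDERIV_gradient[OF assms(1)] by (simp add: gderiv_def)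
  then have "(\<lambda>h. h \<bullet> gradient F x) = (\<lambda>h. 0)"
    by (rule differential_zero_maxmin[of x UNIV F, rotated 2]) (use assms in auto)
  then show ?thesis by (metis inner_eq_zero_iff)
qed

text \<open>The velocity is shifted by \<open>sqrt \<alpha> *\<^sub>R (a - w\<^sub>0)\<close>. With the kinetic energy \<open>(norm b)\<^sup>2 / 2\<close>
  instead, the derivative would be a multiple of \<open>(norm b)\<^sup>2\<close>, which does not control the energy.\<close>
definition heavy_ball_energy :: "real \<Rightarrow> (real^'n \<Rightarrow> real) \<Rightarrow> real^'n \<Rightarrow> real^'n \<Rightarrow> real^'n \<Rightarrow> real" where
  "heavy_ball_energy \<alpha> F w\<^sub>0 a b = F a - F w\<^sub>0 + (norm (sqrt \<alpha> *\<^sub>R (a - w\<^sub>0) + b))\<^sup>2 / 2"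

lemma heavy_ball_energy_coercive:
  fixes F :: "real^'n \<Rightarrow> real"
  assumes "strongly_convex \<alpha> F" and "\<alpha> > 0" and "gradient F w\<^sub>0 = 0"
  shows "(norm (a - w\<^sub>0))\<^sup>2 + (norm b)\<^sup>2 \<le> (2 / \<alpha> + 4) * heavy_ball_energy \<alpha> F w\<^sub>0 a b"
proof -
  define V d g where "V = heavy_ball_energy \<alpha> F w\<^sub>0 a b" and "d = a - w\<^sub>0"
    and "g = sqrt \<alpha> *\<^sub>R d + b"
  have V: "\<alpha> / 2 * (norm d)\<^sup>2 + (norm g)\<^sup>2 / 2 \<le> V"
    using strongly_convex_lower_bound[OF assms(1), of w\<^sub>0 a] assms(3)
    by (simp add: V_def heavy_ball_energy_def d_def g_def)
  have "(norm d)\<^sup>2 \<le> 2 / \<alpha> * V"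
  proof -
    have "\<alpha> * (norm d)\<^sup>2 \<le> 2 * V" using V zero_le_power2[of "norm g"] by linarith
    then show ?thesis using assms(2) by (simp add: field_simps)
  qed
  moreover have "(norm b)\<^sup>2 \<le> 4 * V"
  proof -
    have "(norm b)\<^sup>2 \<le> 2 * (norm g)\<^sup>2 + 2 * (norm (- (sqrt \<alpha> *\<^sub>R d)))\<^sup>2"
      using power2_norm_add_le[of g "- (sqrt \<alpha> *\<^sub>R d)"] by (simp add: g_def)
    also have "(norm (- (sqrt \<alpha> *\<^sub>R d)))\<^sup>2 = \<alpha> * (norm d)\<^sup>2"
      using assms(2) by (simp add: power_mult_distrib)
    finally show ?thesis using V by simp
  qed
  ultimately show ?thesis by (simp add: V_def d_def algebra_simps)
qed

text \<open>The left-hand side is the derivative of the energy along the heavy-ball equation with an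
  additional force \<open>\<delta>\<close>. The terms \<open>gradient F a \<bullet> b\<close> cancel and leave \<open>- s * (G \<bullet> d + b \<bullet> g)\<close> in the
  notation of the proof; strong convexity bounds the bracket from below by the energy. The force
  enters through \<open>g \<bullet> \<delta>\<close>, and the energy controls \<open>(norm g)\<^sup>2 / 2\<close>, so an arbitrarily small part
  \<open>\<upsilon>\<close> of the rate pays for it.\<close>
lemma heavy_ball_energy_dissipation:
  fixes F :: "real^'n \<Rightarrow> real"
  assumes "strongly_convex \<alpha> F" and "\<alpha> > 0" and "gradient F w\<^sub>0 = 0" and "\<upsilon> > 0"
  shows "gradient F a \<bullet> b + (sqrt \<alpha> *\<^sub>R (a - w\<^sub>0) + b)
            \<bullet> (sqrt \<alpha> *\<^sub>R b + (- (2 * sqrt \<alpha>) *\<^sub>R b - gradient F a + \<delta>))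
         \<le> - (sqrt \<alpha> - \<upsilon>) * heavy_ball_energy \<alpha> F w\<^sub>0 a b + (norm \<delta>)\<^sup>2 / (2 * \<upsilon>)"
    (is "?lhs \<le> _")
proof -
  define s V G d g where "s = sqrt \<alpha>" and "V = heavy_ball_energy \<alpha> F w\<^sub>0 a b"
    and "G = gradient F a" and "d = a - w\<^sub>0" and "g = s *\<^sub>R d + b"
  have s: "s > 0" "s * s = \<alpha>" using assms(2) by (simp_all add: s_def)
  have gap: "F a - F w\<^sub>0 \<ge> 0"
  proof -
    have "0 \<le> \<alpha> / 2 * (norm (a - w\<^sub>0))\<^sup>2" using assms(2) by simp
    then show ?thesis
      using strongly_convex_lower_bound[OF assms(1), of w\<^sub>0 a] assms(3) by simp
  qed
  have convex: "F a - F w\<^sub>0 + \<alpha> / 2 * (norm d)\<^sup>2 \<le> G \<bullet> d"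
    using strongly_convex_lower_bound[OF assms(1), of a w\<^sub>0]
    by (simp add: G_def d_def norm_minus_commute inner_diff_right)
  have polar: "b \<bullet> g = ((norm g)\<^sup>2 + (norm b)\<^sup>2 - \<alpha> * (norm d)\<^sup>2) / 2"
    by (simp add: g_def power2_norm_eq_inner inner_add_left inner_add_right inner_commute
        s(2)[symmetric] algebra_simps)
  have "?lhs = - s * (G \<bullet> d + b \<bullet> g) + g \<bullet> \<delta>"
    unfolding s_def[symmetric] G_def[symmetric] d_def[symmetric] g_def[symmetric]
    by (simp add: g_def inner_add_left inner_add_right inner_diff_right inner_commute
        algebra_simps)
  also have "\<dots> \<le> - s * V + g \<bullet> \<delta>"
  proof -
    have "V \<le> G \<bullet> d + b \<bullet> g"
      using convex zero_le_power2[of "norm b"] unfolding polar V_def heavy_ball_energy_def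
        d_def[symmetric] s_def[symmetric] g_def[symmetric] by argo
    then show ?thesis using s(1) by simp
  qed
  also have "g \<bullet> \<delta> \<le> \<upsilon> * V + (norm \<delta>)\<^sup>2 / (2 * \<upsilon>)"
  proof -
    have "(norm g)\<^sup>2 / 2 \<le> V"
      using gap by (simp add: V_def heavy_ball_energy_def d_def s_def g_def)
    then have "\<upsilon> / 2 * (norm g)\<^sup>2 \<le> \<upsilon> * V"
      using assms(4) mult_left_mono[of "(norm g)\<^sup>2 / 2" V \<upsilon>] by simp
    moreover have "g \<bullet> \<delta> \<le> \<upsilon> / 2 * (norm g)\<^sup>2 + (norm \<delta>)\<^sup>2 / (2 * \<upsilon>)"
      using inner_le_weighted_squares[of "\<upsilon> / 2" g \<delta>] assms(4) by simp
    ultimately show ?thesis by linarith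
  qed
  finally show ?thesis by (simp add: s_def V_def algebra_simps)
qed

lemma has_real_derivative_heavy_ball_energy:
  fixes F :: "real^'n \<Rightarrow> real"
  assumes "F differentiable (at (a t))"
    and a: "(a has_vector_derivative a') (at t within S)"
    and b: "(b has_vector_derivative b') (at t within S)"
  shows "((\<lambda>t. heavy_ball_energy \<alpha> F w\<^sub>0 (a t) (b t)) has_real_derivative
    gradient F (a t) \<bullet> a' + (sqrt \<alpha> *\<^sub>R (a t - w\<^sub>0) + b t) \<bullet> (sqrt \<alpha> *\<^sub>R a' + b')) (at t within S)"
proof -
  have "GDERIV F (a t) :> gradient F (a t)"
    by (rule GDERIV_gradient[OF assms(1)])
  then have "((\<lambda>t. F (a t)) has_derivative (\<lambda>h. (h *\<^sub>R a') \<bullet> gradient F (a t))) (at t within S)"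
    unfolding gderiv_def
    by (rule has_derivative_compose[where g=F, rotated]) (use a in \<open>simp add: has_vector_derivative_def\<close>)
  then have 1: "((\<lambda>t. F (a t)) has_real_derivative gradient F (a t) \<bullet> a') (at t within S)"
    by (simp add: has_field_derivative_def inner_commute mult_commute_abs)
  have g: "((\<lambda>t. sqrt \<alpha> *\<^sub>R (a t - w\<^sub>0) + b t) has_vector_derivative sqrt \<alpha> *\<^sub>R a' + b') (at t within S)"
    using a b by (auto intro!: derivative_eq_intros)
  show ?thesis
    using DERIV_add[OF DERIV_diff[OF 1 DERIV_const[of "F w\<^sub>0"]]
        DERIV_cdivide[OF has_real_derivative_inner[OF g g], of 2]]
    by (simp add: heavy_ball_energy_def power2_norm_eq_inner inner_commute[of "sqrt \<alpha> *\<^sub>R a' + b'"])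
qed

section \<open>Dissipation of the disagreement\<close>

text \<open>Hypocoercivity: in the derivative of \<open>(norm e)\<^sup>2 / 2 + (norm h)\<^sup>2 / 2\<close> the terms coupling \<open>e\<close> and
  \<open>h\<close> cancel, and only \<open>e\<close> is damped. The derivative of \<open>e \<bullet> h\<close> contains \<open>- k * (h \<bullet> L h)\<close>, which
  damps \<open>h\<close>. Its other terms, \<open>- p * (h \<bullet> L e)\<close> and \<open>k * (e \<bullet> L e)\<close>, must be absorbed by the damping
  of \<open>e\<close> and a part of this new damping of \<open>h\<close>, which forces a weight of order \<open>k / p\<close>.\<close>
lemma disagreement_dissipation:
  fixes L :: "'a::real_inner \<Rightarrow> 'a"
  assumes "linear L" and sa: "\<And>x y. L x \<bullet> y = x \<bullet> L y" and nonneg: "\<And>x. L x \<bullet> x \<ge> 0"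
    and le: "l * (norm e)\<^sup>2 \<le> L e \<bullet> e" and lh: "l * (norm h)\<^sup>2 \<le> L h \<bullet> h"
    and "l > 0" "k > 0" "k \<le> p"
    and e': "e' = u - p *\<^sub>R L e - k *\<^sub>R L h" and h': "h' = k *\<^sub>R L e"
  shows "e \<bullet> e' + h \<bullet> h' + k / (4 * p) * (e' \<bullet> h + e \<bullet> h')
         \<le> - (p * l / 4) * (norm e)\<^sup>2 - (k\<^sup>2 * l / (16 * p)) * (norm h)\<^sup>2
            + 5 / (4 * p * l) * (norm u)\<^sup>2"
proof -
  have p: "p > 0" using assms by simp
  define P Q R where "P = L e \<bullet> e" and "Q = L h \<bullet> h" and "R = L e \<bullet> h"
  have R: "L h \<bullet> e = R" "e \<bullet> L h = R" "h \<bullet> L e = R"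
    using sa[of h e] by (simp_all add: R_def inner_commute)
  have PQ: "e \<bullet> L e = P" "h \<bullet> L h = Q" "L e \<bullet> h = R" "L e \<bullet> e = P" "L h \<bullet> h = Q"
    by (simp_all add: P_def Q_def R_def inner_commute)
  have inners: "e \<bullet> e' = e \<bullet> u - p * P - k * R" "h \<bullet> h' = k * R"
    "e' \<bullet> h = h \<bullet> u - p * R - k * Q" "e \<bullet> h' = k * P"
    by (simp_all only: e' h' inner_diff_left inner_diff_right inner_scaleR_left inner_scaleR_right
        PQ R inner_commute[of u h])
  have "e \<bullet> e' + h \<bullet> h' + k / (4 * p) * (e' \<bullet> h + e \<bullet> h')
      = e \<bullet> u + k / (4 * p) * (h \<bullet> u) - p * P - k\<^sup>2 / (4 * p) * Q + k\<^sup>2 / (4 * p) * P - k / 4 * R"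
    unfolding inners using p by (simp add: field_simps power2_eq_square)
  moreover have "- (k / 4 * R) \<le> k\<^sup>2 / (8 * p) * Q + p / 8 * P"
  proof -
    \<comment> \<open>Young's inequality for the semi-inner product \<open>L x \<bullet> y\<close>, with weights that use half of the
      damping of \<open>h\<close> and an eighth of the damping of \<open>e\<close>.\<close>
    have "0 \<le> L (p *\<^sub>R e + k *\<^sub>R h) \<bullet> (p *\<^sub>R e + k *\<^sub>R h)" by (rule nonneg)
    also have "\<dots> = p * p * P + 2 * (p * k * R) + k * k * Q"
      unfolding linear_add[OF assms(1)] linear_cmul[OF assms(1)] inner_add_left inner_add_right
        inner_scaleR_left inner_scaleR_right PQ R by algebra
    also have "\<dots> = 8 * p * (k\<^sup>2 / (8 * p) * Q + p / 8 * P + k / 4 * R)"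
      using p by (simp add: field_simps power2_eq_square)
    finally show ?thesis using p by (simp add: zero_le_mult_iff)
  qed
  moreover have "k\<^sup>2 / (4 * p) * P \<le> p / 4 * P"
  proof (rule mult_right_mono)
    have "k\<^sup>2 \<le> p\<^sup>2" using assms by (simp add: power_mono)
    then show "k\<^sup>2 / (4 * p) \<le> p / 4" using p by (simp add: field_simps power2_eq_square)
  qed (simp add: P_def nonneg)
  moreover have "p * (l * (norm e)\<^sup>2) \<le> p * P"
    using le p by (simp add: P_def)
  moreover have "k\<^sup>2 / (8 * p) * (l * (norm h)\<^sup>2) \<le> k\<^sup>2 / (8 * p) * Q"
    using lh p by (intro mult_left_mono) (auto simp: Q_def)
  moreover have "P \<ge> 0" "p * P \<ge> 0" using nonneg p by (auto simp: P_def)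
  moreover have "e \<bullet> u \<le> p * l / 4 * (norm e)\<^sup>2 + (norm u)\<^sup>2 / (p * l)"
    using inner_le_weighted_squares[of "p * l / 4" e u] p assms by simp
  moreover have "k / (4 * p) * (h \<bullet> u) \<le> k\<^sup>2 * l / (16 * p) * (norm h)\<^sup>2 + (norm u)\<^sup>2 / (4 * p * l)"
  proof -
    have "k / (4 * p) * (h \<bullet> u) \<le> k / (4 * p) * (k * l / 4 * (norm h)\<^sup>2 + (norm u)\<^sup>2 / (k * l))"
      using inner_le_weighted_squares[of "k * l / 4" h u] p assms by (intro mult_left_mono) auto
    also have "\<dots> = k\<^sup>2 * l / (16 * p) * (norm h)\<^sup>2 + (norm u)\<^sup>2 / (4 * p * l)"
      using p assms by (simp add: field_simps power2_eq_square)
    finally show ?thesis .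
  qed
  moreover have "5 / (4 * p * l) * (norm u)\<^sup>2 = (norm u)\<^sup>2 / (p * l) + (norm u)\<^sup>2 / (4 * p * l)"
    using p assms by (simp add: field_simps)
  moreover have "k\<^sup>2 * l / (16 * p) * (norm h)\<^sup>2 * 2 = k\<^sup>2 / (8 * p) * (l * (norm h)\<^sup>2)"
    using p by (simp add: field_simps)
  moreover have "k\<^sup>2 / (4 * p) * Q = 2 * (k\<^sup>2 / (8 * p) * Q)"
    using p by (simp add: field_simps)
  moreover have "p * l / 4 * (norm e)\<^sup>2 = p * (l * (norm e)\<^sup>2) / 4" "p / 4 * P = p * P / 4" "p / 8 * P = p * P / 8"
    by simp_all
  ultimately show ?thesis by linarith
qed

text \<open>The cross term of the disagreement energy does not spoil its equivalence to the squared norm.\<close>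
lemma disagreement_energy_bounds:
  fixes e h :: "'a::real_inner"
  assumes "0 \<le> \<kappa>" "\<kappa> \<le> 1 / 4"
  shows "((norm e)\<^sup>2 + (norm h)\<^sup>2) / 4 \<le> (norm e)\<^sup>2 / 2 + (norm h)\<^sup>2 / 2 + \<kappa> * (e \<bullet> h)"
    and "(norm e)\<^sup>2 / 2 + (norm h)\<^sup>2 / 2 + \<kappa> * (e \<bullet> h) \<le> (norm e)\<^sup>2 + (norm h)\<^sup>2"
proof -
  have "\<bar>e \<bullet> h\<bar> \<le> ((norm e)\<^sup>2 + (norm h)\<^sup>2) / 2"
    using Cauchy_Schwarz_ineq2[of e h] sum_squares_bound[of "norm e" "norm h"] by simp
  then have "\<bar>\<kappa> * (e \<bullet> h)\<bar> \<le> 1 / 4 * (((norm e)\<^sup>2 + (norm h)\<^sup>2) / 2)"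
    unfolding abs_mult using assms by (intro mult_mono) auto
  then show "((norm e)\<^sup>2 + (norm h)\<^sup>2) / 4 \<le> (norm e)\<^sup>2 / 2 + (norm h)\<^sup>2 / 2 + \<kappa> * (e \<bullet> h)"
    and "(norm e)\<^sup>2 / 2 + (norm h)\<^sup>2 / 2 + \<kappa> * (e \<bullet> h) \<le> (norm e)\<^sup>2 + (norm h)\<^sup>2"
    using zero_le_power2[of "norm e"] zero_le_power2[of "norm h"]
    by (auto simp: abs_le_iff)
qed

lemma has_real_derivative_disagreement_energy:
  fixes e h :: "real \<Rightarrow> 'a::real_inner"
  assumes e: "(e has_vector_derivative e') (at t within S)" and h: "(h has_vector_derivative h') (at t within S)"
  shows "((\<lambda>t. (norm (e t))\<^sup>2 / 2 + (norm (h t))\<^sup>2 / 2 + \<kappa> * (e t \<bullet> h t)) has_real_derivative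
    e t \<bullet> e' + h t \<bullet> h' + \<kappa> * (e' \<bullet> h t + e t \<bullet> h')) (at t within S)"
  using DERIV_add[OF DERIV_add[OF DERIV_cdivide[OF has_real_derivative_inner[OF e e], of 2]
        DERIV_cdivide[OF has_real_derivative_inner[OF h h], of 2]]
      DERIV_cmult[OF has_real_derivative_inner[OF e h], of \<kappa>]]
  by (simp add: power2_norm_eq_inner inner_commute[of e'] inner_commute[of h'])

section \<open>The stacked system\<close>

lemma fst_mean: "fst (mean x) = mean (\<chi> i. fst (x $ i))"
  and snd_mean: "snd (mean x) = mean (\<chi> i. snd (x $ i))"
  by (simp_all add: mean_def fst_sum snd_sum)

lemma gradient_average:
  fixes f :: "'v::finite \<Rightarrow> real^'n \<Rightarrow> real"
  assumes "\<And>i. f i differentiable (at x)"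
  shows "gradient (average f) x = mean (\<chi> i. gradient (f i) x)"
proof (rule gradient_eqI)
  have "(f i has_derivative (\<lambda>h. h \<bullet> gradient (f i) x)) (at x)" for i
    using GDERIV_gradient[OF assms] by (simp add: gderiv_def)
  then have "((\<lambda>w. (1 / real CARD('v)) * (\<Sum>i\<in>UNIV. f i w)) has_derivative
      (\<lambda>h. (1 / real CARD('v)) * (\<Sum>i\<in>UNIV. h \<bullet> gradient (f i) x))) (at x)"
    by (intro has_derivative_mult_right has_derivative_sum)
  then show "GDERIV (average f) x :> mean (\<chi> i. gradient (f i) x)"
    by (simp add: gderiv_def average_def[abs_def] mean_def inner_sum_right)
qed

text \<open>This is \<open>\<Phi>\<close> in the introduction.\<close>
definition stacked_field ::
    "real \<Rightarrow> ('v::finite \<Rightarrow> real^'n \<Rightarrow> real) \<Rightarrow> ((real^'n) \<times> (real^'n))^'v \<Rightarrow> ((real^'n) \<times> (real^'n))^'v" where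
  "stacked_field \<alpha> f x = (\<chi> i. heavy_ball_field \<alpha> (f i) (x $ i))"

lemma stacked_field_lipschitz:
  assumes "\<And>i. l-lipschitz_on UNIV (gradient (f i))" and "\<alpha> > 0"
  shows "norm (stacked_field \<alpha> f x - stacked_field \<alpha> f y) \<le> (1 + 2 * sqrt \<alpha> + l) * norm (x - y)"
proof -
  have l: "l \<ge> 0" using assms(1) by (rule lipschitz_on_nonneg)
  have field: "norm (heavy_ball_field \<alpha> (f i) p - heavy_ball_field \<alpha> (f i) q)
      \<le> (1 + 2 * sqrt \<alpha> + l) * norm (p - q)" for i p q
  proof -
    have g: "norm (gradient (f i) (fst p) - gradient (f i) (fst q)) \<le> l * norm (p - q)"
    proof -
      have "norm (gradient (f i) (fst p) - gradient (f i) (fst q)) \<le> l * norm (fst (p - q))"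
        using lipschitz_onD[OF assms(1), of "fst p" "fst q"] by (simp add: dist_norm)
      also have "\<dots> \<le> l * norm (p - q)" using l norm_fst_snd_le(1)[of "p - q"]
        by (intro mult_left_mono)
      finally show ?thesis .
    qed
    have "norm (heavy_ball_field \<alpha> (f i) p - heavy_ball_field \<alpha> (f i) q)
       \<le> norm (snd p - snd q) + norm (- (2 * sqrt \<alpha>) *\<^sub>R (snd p - snd q)
            - (gradient (f i) (fst p) - gradient (f i) (fst q)))"
      using norm_Pair_le[of "snd p - snd q" "- (2 * sqrt \<alpha>) *\<^sub>R (snd p - snd q)
            - (gradient (f i) (fst p) - gradient (f i) (fst q))"]
      by (simp add: heavy_ball_field_def case_prod_beta algebra_simps)
    also have "\<dots> \<le> norm (snd p - snd q) + (norm (- (2 * sqrt \<alpha>) *\<^sub>R (snd p - snd q))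
            + norm (gradient (f i) (fst p) - gradient (f i) (fst q)))"
      by (intro add_left_mono norm_triangle_ineq4)
    also have "norm (- (2 * sqrt \<alpha>) *\<^sub>R (snd p - snd q)) = 2 * sqrt \<alpha> * norm (snd p - snd q)"
      using assms(2) by simp
    also have "norm (snd p - snd q) + (2 * sqrt \<alpha> * norm (snd p - snd q)
            + norm (gradient (f i) (fst p) - gradient (f i) (fst q)))
       \<le> norm (p - q) + (2 * sqrt \<alpha> * norm (p - q) + l * norm (p - q))"
    proof -
      have "norm (snd p - snd q) \<le> norm (p - q)"
        using norm_fst_snd_le(2)[of "p - q"] by simp
      then show ?thesis using g assms(2) by (intro add_mono mult_left_mono) auto
    qed
    finally show ?thesis by (simp add: algebra_simps)
  qed
  have "(norm (stacked_field \<alpha> f x - stacked_field \<alpha> f y))\<^sup>2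
      = (\<Sum>i\<in>UNIV. (norm (heavy_ball_field \<alpha> (f i) (x $ i) - heavy_ball_field \<alpha> (f i) (y $ i)))\<^sup>2)"
    by (simp add: power2_norm_eq_inner inner_vec_def stacked_field_def)
  also have "\<dots> \<le> (\<Sum>i\<in>UNIV. ((1 + 2 * sqrt \<alpha> + l) * norm (x $ i - y $ i))\<^sup>2)"
    by (intro sum_mono power_mono field) auto
  also have "\<dots> = ((1 + 2 * sqrt \<alpha> + l) * norm (x - y))\<^sup>2"
    by (simp add: power_mult_distrib power2_norm_eq_inner inner_vec_def flip: sum_distrib_left)
  finally show ?thesis
    by (rule power2_le_imp_le) (use l assms(2) in auto)
qed

lemma mean_stacked_field:
  fixes f :: "'v::finite \<Rightarrow> real^'n \<Rightarrow> real"
  shows "mean (stacked_field \<alpha> f x) =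
    (snd (mean x), - (2 * sqrt \<alpha>) *\<^sub>R snd (mean x) - mean (\<chi> i. gradient (f i) (fst (x $ i))))"
proof (rule prod_eqI)
  show "fst (mean (stacked_field \<alpha> f x)) = fst (snd (mean x), - (2 * sqrt \<alpha>) *\<^sub>R snd (mean x)
      - mean (\<chi> i. gradient (f i) (fst (x $ i))))"
    by (simp add: fst_mean snd_mean stacked_field_def heavy_ball_field_def case_prod_beta)
  have "(\<chi> i. snd (stacked_field \<alpha> f x $ i)) = - (2 * sqrt \<alpha>) *\<^sub>R (\<chi> i. snd (x $ i))
      - (\<chi> i. gradient (f i) (fst (x $ i)))"
    by (simp add: vec_eq_iff stacked_field_def heavy_ball_field_def case_prod_beta)
  then show "snd (mean (stacked_field \<alpha> f x)) = snd (snd (mean x), - (2 * sqrt \<alpha>) *\<^sub>R snd (mean x)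
      - mean (\<chi> i. gradient (f i) (fst (x $ i))))"
    by (simp only: snd_mean linear_diff[OF linear_mean] linear_cmul[OF linear_mean] snd_conv)
qed

text \<open>The error made by averaging the gradients at the positions of the agents instead of at their
  mean is controlled by the disagreement alone. Therefore it vanishes at consensus, although the
  individual gradients need not vanish there.\<close>
lemma averaged_gradient_error:
  fixes f :: "'v::finite \<Rightarrow> real^'n \<Rightarrow> real"
  assumes "\<And>i x. f i differentiable (at x)" and lip: "\<And>i. l-lipschitz_on UNIV (gradient (f i))"
  shows "norm (gradient (average f) (fst (mean x)) - mean (\<chi> i. gradient (f i) (fst (x $ i))))
    \<le> l * norm (deviation x)"
proof -
  have l: "l \<ge> 0" using lip by (rule lipschitz_on_nonneg)
  have "gradient (average f) (fst (mean x)) - mean (\<chi> i. gradient (f i) (fst (x $ i)))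
      = mean ((\<chi> i. gradient (f i) (fst (mean x))) - (\<chi> i. gradient (f i) (fst (x $ i))))"
    by (simp add: gradient_average[OF assms(1)] linear_diff[OF linear_mean])
  also have "norm \<dots> \<le> l * norm (deviation x)"
  proof (rule norm_mean_le)
    fix i
    have "norm (gradient (f i) (fst (mean x)) - gradient (f i) (fst (x $ i)))
        \<le> l * norm (fst (x $ i) - fst (mean x))"
      using lipschitz_onD[OF lip, of "fst (mean x)" "fst (x $ i)"]
      by (simp add: dist_norm norm_minus_commute)
    also have "\<dots> \<le> l * norm (deviation x)"
    proof (rule mult_left_mono[OF _ l])
      have "norm (fst (x $ i) - fst (mean x)) \<le> norm (deviation x $ i)"
        using norm_fst_snd_le(1)[of "deviation x $ i"] by (simp add: deviation_def)
      also have "\<dots> \<le> norm (deviation x)" by (rule Finite_Cartesian_Product.norm_nth_le)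
      finally show "norm (fst (x $ i) - fst (mean x)) \<le> norm (deviation x)" .
    qed
    finally show "norm (((\<chi> i. gradient (f i) (fst (mean x))) - (\<chi> i. gradient (f i) (fst (x $ i)))) $ i)
        \<le> l * norm (deviation x)" by simp
  qed
  finally show ?thesis .
qed

lemma distributed_heavy_ball_stacked:
  assumes "distributed_heavy_ball_solution \<alpha> E f kP kI w z \<xi>" and "t \<ge> 0"
  defines "x \<equiv> \<lambda>t. (\<chi> i. (w i t, z i t))" and "y \<equiv> \<lambda>t. (\<chi> i. \<xi> i t)"
  shows "(x has_vector_derivative
           stacked_field \<alpha> f (x t) - kP *\<^sub>R laplacian E (x t) - kI *\<^sub>R laplacian E (y t)) (at t within {0..})"
    and "(y has_vector_derivative kI *\<^sub>R laplacian E (x t)) (at t within {0..})"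
proof -
  have sol: "((\<lambda>s. (w i s, z i s)) has_vector_derivative
           heavy_ball_field \<alpha> (f i) (w i t, z i t)
           + kP *\<^sub>R (\<Sum>j\<in>neighbors E i. (w j t, z j t) - (w i t, z i t))
           + kI *\<^sub>R (\<Sum>j\<in>neighbors E i. \<xi> j t - \<xi> i t)) (at t within {0..})"
    "(\<xi> i has_vector_derivative
           - kI *\<^sub>R (\<Sum>j\<in>neighbors E i. (w j t, z j t) - (w i t, z i t))) (at t within {0..})" for i
    using assms(1,2) unfolding distributed_heavy_ball_solution_def by blast+
  show "(x has_vector_derivative
           stacked_field \<alpha> f (x t) - kP *\<^sub>R laplacian E (x t) - kI *\<^sub>R laplacian E (y t)) (at t within {0..})"
    by (rule has_vector_derivative_vec)
       (use sol(1) in \<open>simp add: x_def y_def stacked_field_def laplacian_nth\<close>)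
  show "(y has_vector_derivative kI *\<^sub>R laplacian E (x t)) (at t within {0..})"
    by (rule has_vector_derivative_vec) (use sol(2) in \<open>simp add: x_def y_def laplacian_nth\<close>)
qed

section \<open>Decay of the total energy\<close>

text \<open>The left-hand side is the derivative of the total energy, the bracket on the right its value.
  The lower bounds on \<open>p\<close> absorb the two couplings: the first one makes the
  forcing of the disagreement by the error of the mean cost at most \<open>\<upsilon>\<close> of the rate of the mean, and
  the second one lets the damping of the disagreement dominate both its feedback on the mean
  and its own Lipschitz forcing, leaving a surplus \<open>sqrt \<alpha> * (norm e)\<^sup>2\<close>.\<close>
lemma total_energy_dissipation:
  fixes f :: "'v::finite \<Rightarrow> real^'n \<Rightarrow> real" and x y \<eta> :: "((real^'n) \<times> (real^'n))^'v"
  assumes diff: "\<And>i x. f i differentiable (at x)"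
    and lip: "\<And>i. l-lipschitz_on UNIV (gradient (f i))"
    and "\<alpha> > 0" and convex: "strongly_convex \<alpha> (average f)"
    and crit: "gradient (average f) w\<^sub>0 = 0"
    and sym: "sym E"
    and \<mu>: "\<mu> > 0" "\<And>x :: ((real^'n) \<times> (real^'n))^'v. \<mu> * (norm (deviation x))\<^sup>2 \<le> laplacian E x \<bullet> x"
    and "\<upsilon> > 0" and k: "k > 0" "k \<le> p" and "p \<ge> 1"
    and p: "p \<ge> 5 * (1 + 2 * sqrt \<alpha> + l)\<^sup>2 / (4 * \<mu>) * (real CARD('v) * (2 / \<alpha> + 4)) / \<upsilon>"
      "p \<ge> 4 / \<mu> * (sqrt \<alpha> + l\<^sup>2 / (2 * \<upsilon>) + 5 * (1 + 2 * sqrt \<alpha> + l)\<^sup>2 / (4 * \<mu>))"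
    and \<rho>: "\<rho> \<ge> 0" "\<rho> \<le> sqrt \<alpha> - 2 * \<upsilon>" "\<rho> \<le> k\<^sup>2 * \<mu> / (16 * p)"
  defines "m \<equiv> mean x"
    and "e \<equiv> deviation x"
    and "x' \<equiv> stacked_field \<alpha> f x - p *\<^sub>R laplacian E x - k *\<^sub>R laplacian E y"
    and "h \<equiv> deviation (y - \<eta>)" and "h' \<equiv> deviation (k *\<^sub>R laplacian E x)"
  assumes \<eta>: "k *\<^sub>R laplacian E \<eta> = stacked_field \<alpha> f (\<chi> i. (w\<^sub>0, 0))"
  shows "(gradient (average f) (fst m) \<bullet> fst (mean x')
         + (sqrt \<alpha> *\<^sub>R (fst m - w\<^sub>0) + snd m) \<bullet> (sqrt \<alpha> *\<^sub>R fst (mean x') + snd (mean x')))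
       + (e \<bullet> deviation x' + h \<bullet> h' + k / (4 * p) * (deviation x' \<bullet> h + e \<bullet> h'))
     \<le> - \<rho> * (heavy_ball_energy \<alpha> (average f) w\<^sub>0 (fst m) (snd m)
               + ((norm e)\<^sup>2 / 2 + (norm h)\<^sup>2 / 2 + k / (4 * p) * (e \<bullet> h)))"
    (is "?mean_part + ?deviation_part \<le> _")
proof -
  define s where "s = sqrt \<alpha>"
  define V where "V = heavy_ball_energy \<alpha> (average f) w\<^sub>0 (fst m) (snd m)"
  define x\<^sub>0 :: "((real^'n) \<times> (real^'n))^'v" where "x\<^sub>0 = (\<chi> i. (w\<^sub>0, 0))"
  define u where "u = deviation (stacked_field \<alpha> f x - stacked_field \<alpha> f x\<^sub>0)"
  define c where "c = 1 + 2 * s + l"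
  define D where "D = 5 * c\<^sup>2 / (4 * \<mu>)"
  define N where "N = real CARD('v) * (2 / \<alpha> + 4)"
  have ppos: "p > 0" using k by simp
  have l: "l \<ge> 0" using lip by (rule lipschitz_on_nonneg)
  have N: "N \<ge> 0" using \<open>\<alpha> > 0\<close> by (simp add: N_def)
  have D: "D \<ge> 0" using \<mu> by (simp add: D_def)

  have "(norm (m - (w\<^sub>0, 0)))\<^sup>2 \<le> (2 / \<alpha> + 4) * V"
  proof -
    have "(norm (m - (w\<^sub>0, 0)))\<^sup>2 = (norm (fst m - w\<^sub>0))\<^sup>2 + (norm (snd m))\<^sup>2"
      by (cases m) (simp add: norm_prod_def)
    then show ?thesis
      using heavy_ball_energy_coercive[OF convex \<open>\<alpha> > 0\<close> crit, of "fst m" "snd m"] by (simp add: V_def)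
  qed
  then have "real CARD('v) * (norm (m - (w\<^sub>0, 0)))\<^sup>2 \<le> N * V"
    unfolding N_def mult.assoc by (rule mult_left_mono) simp
  then have x_dist: "(norm (x - x\<^sub>0))\<^sup>2 \<le> (norm e)\<^sup>2 + N * V"
    unfolding x\<^sub>0_def norm_sq_deviation_mean by (simp add: m_def e_def)
  have V: "V \<ge> 0"
    using heavy_ball_energy_coercive[OF convex \<open>\<alpha> > 0\<close> crit, of "fst m" "snd m"] \<open>\<alpha> > 0\<close>
    unfolding V_def[symmetric]
    by (smt (verit) divide_pos_pos zero_le_power2 zero_le_mult_iff)

  \<comment> \<open>At equilibrium, \<open>\<eta>\<close> compensates the fields at the consensus state, so that only differences of
    the field remain as forcing.\<close>
  have lap_y: "k *\<^sub>R laplacian E y = k *\<^sub>R laplacian E h + stacked_field \<alpha> f x\<^sub>0"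
    by (simp add: h_def laplacian_deviation linear_diff[OF linear_laplacian] scaleR_diff_right \<eta> x\<^sub>0_def)
  have dev_h [simp]: "deviation h = h" and dev_e [simp]: "deviation e = e"
    by (simp_all add: h_def e_def deviation_eq[of "deviation _"] vec_eq_iff)
  have x': "x' = (stacked_field \<alpha> f x - stacked_field \<alpha> f x\<^sub>0) - p *\<^sub>R laplacian E e - k *\<^sub>R laplacian E h"
    by (simp add: x'_def lap_y e_def laplacian_deviation)
  have dev_x': "deviation x' = u - p *\<^sub>R laplacian E e - k *\<^sub>R laplacian E h"
    by (simp add: x' u_def linear_diff[OF linear_deviation] linear_cmul[OF linear_deviation]
        deviation_laplacian[OF sym])
  have h': "h' = k *\<^sub>R laplacian E e"
    by (simp add: h'_def linear_cmul[OF linear_deviation] deviation_laplacian[OF sym] e_def laplacian_deviation)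

  have disagreement: "e \<bullet> deviation x' + h \<bullet> h' + k / (4 * p) * (deviation x' \<bullet> h + e \<bullet> h')
      \<le> - (p * \<mu> / 4) * (norm e)\<^sup>2 - (k\<^sup>2 * \<mu> / (16 * p)) * (norm h)\<^sup>2
            + 5 / (4 * p * \<mu>) * (norm u)\<^sup>2"
    using \<mu>(2)[of e] \<mu>(2)[of h]
    by (intro disagreement_dissipation[where L="laplacian E", OF linear_laplacian
          laplacian_self_adjoint[OF sym] laplacian_nonneg[OF sym] _ _ \<mu>(1) k dev_x' h']) simp_all
  have "norm u \<le> c * norm (x - x\<^sub>0)"
    unfolding u_def c_def s_def
    by (rule order_trans[OF norm_deviation_le]) (rule stacked_field_lipschitz[OF lip \<open>\<alpha> > 0\<close>])
  then have "(norm u)\<^sup>2 \<le> c\<^sup>2 * (norm (x - x\<^sub>0))\<^sup>2"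
    unfolding power_mult_distrib[symmetric] by (rule power_mono) simp
  also have "\<dots> \<le> c\<^sup>2 * ((norm e)\<^sup>2 + N * V)"
    by (rule mult_left_mono[OF x_dist]) simp
  finally have "5 / (4 * p * \<mu>) * (norm u)\<^sup>2 \<le> 5 / (4 * p * \<mu>) * (c\<^sup>2 * ((norm e)\<^sup>2 + N * V))"
    using ppos \<mu> by (intro mult_left_mono) auto
  also have "\<dots> = D / p * (norm e)\<^sup>2 + D * N / p * V"
    using ppos \<mu>(1) by (simp add: D_def field_simps)
  also have "\<dots> \<le> D * (norm e)\<^sup>2 + \<upsilon> * V"
  proof (intro add_mono mult_right_mono V)
    show "D / p \<le> D" using D \<open>p \<ge> 1\<close> mult_left_mono[of 1 p D] by (simp add: divide_le_eq)
    show "D * N / p \<le> \<upsilon>"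
      using p(1) ppos \<open>\<upsilon> > 0\<close> unfolding s_def[symmetric] c_def[symmetric] D_def[symmetric] N_def[symmetric]
      by (simp add: field_simps)
  qed simp
  finally have coupling: "5 / (4 * p * \<mu>) * (norm u)\<^sup>2 \<le> D * (norm e)\<^sup>2 + \<upsilon> * V" .

  define \<delta> where "\<delta> = gradient (average f) (fst m) - mean (\<chi> i. gradient (f i) (fst (x $ i)))"
  have mean_x': "mean x' = (snd m, - (2 * s) *\<^sub>R snd m - gradient (average f) (fst m) + \<delta>)"
    by (simp add: x'_def \<delta>_def linear_diff[OF linear_mean] linear_cmul[OF linear_mean]
        mean_laplacian[OF sym] mean_stacked_field m_def s_def)
  have "norm \<delta> \<le> l * norm e"
    unfolding \<delta>_def m_def e_def by (rule averaged_gradient_error[OF diff lip])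
  then have "(norm \<delta>)\<^sup>2 \<le> l\<^sup>2 * (norm e)\<^sup>2"
    unfolding power_mult_distrib[symmetric] by (rule power_mono) simp
  then have \<delta>: "(norm \<delta>)\<^sup>2 / (2 * \<upsilon>) \<le> l\<^sup>2 / (2 * \<upsilon>) * (norm e)\<^sup>2"
    using \<open>\<upsilon> > 0\<close> by (simp add: divide_right_mono)
  have average: "gradient (average f) (fst m) \<bullet> fst (mean x')
       + (s *\<^sub>R (fst m - w\<^sub>0) + snd m) \<bullet> (s *\<^sub>R fst (mean x') + snd (mean x'))
       \<le> - (s - \<upsilon>) * V + (norm \<delta>)\<^sup>2 / (2 * \<upsilon>)"
    using heavy_ball_energy_dissipation[OF convex \<open>\<alpha> > 0\<close> crit \<open>\<upsilon> > 0\<close>, of "fst m" "snd m" \<delta>]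
    by (simp add: mean_x' s_def V_def)

  have gain: "(s + l\<^sup>2 / (2 * \<upsilon>) + D) * (norm e)\<^sup>2 \<le> p * \<mu> / 4 * (norm e)\<^sup>2"
  proof (rule mult_right_mono)
    have "4 / \<mu> * (s + l\<^sup>2 / (2 * \<upsilon>) + D) \<le> p"
      using p(2) by (simp add: s_def c_def D_def)
    then have "\<mu> / 4 * (4 / \<mu> * (s + l\<^sup>2 / (2 * \<upsilon>) + D)) \<le> \<mu> / 4 * p"
      by (rule mult_left_mono) (use \<mu> in simp)
    then show "s + l\<^sup>2 / (2 * \<upsilon>) + D \<le> p * \<mu> / 4"
      using \<mu>(1) by (simp add: mult.commute)
  qed simp

  define V1 where "V1 = (norm e)\<^sup>2 / 2 + (norm h)\<^sup>2 / 2 + k / (4 * p) * (e \<bullet> h)"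
  have "V1 \<le> (norm e)\<^sup>2 + (norm h)\<^sup>2"
    unfolding V1_def using k ppos by (intro disagreement_energy_bounds) (auto simp: field_simps)
  then have "\<rho> * V1 \<le> \<rho> * (norm e)\<^sup>2 + \<rho> * (norm h)\<^sup>2"
    using \<rho>(1) by (simp flip: distrib_left add: mult_left_mono)
  moreover have "\<rho> * (norm e)\<^sup>2 \<le> s * (norm e)\<^sup>2"
    using \<rho>(2) \<open>\<upsilon> > 0\<close> by (intro mult_right_mono) (auto simp: s_def)
  moreover have "\<rho> * (norm h)\<^sup>2 \<le> k\<^sup>2 * \<mu> / (16 * p) * (norm h)\<^sup>2"
    using \<rho>(3) by (intro mult_right_mono) auto
  moreover have "\<rho> * V \<le> (s - 2 * \<upsilon>) * V"
    using \<rho>(2) V by (intro mult_right_mono) (auto simp: s_def)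
  ultimately have "?mean_part + ?deviation_part \<le> - \<rho> * (V + V1)"
    using average disagreement coupling \<delta> gain unfolding s_def[symmetric]
    by (simp only: mult_minus_left distrib_left distrib_right left_diff_distrib minus_add_distrib mult.assoc)
  then show ?thesis
    unfolding V_def V1_def .
qed

text \<open>Both claims about the algorithm are instances of this estimate. The constants \<open>P\<close> and \<open>c\<close> are
  independent of \<open>k\<close> and \<open>p\<close>, so \<open>p\<close> may be chosen as a function of \<open>k\<close>.\<close>
lemma distributed_heavy_ball_decay:
  fixes f :: "'v::finite \<Rightarrow> real^'n \<Rightarrow> real" and E :: "('v \<times> 'v) set"
  assumes diff: "\<And>i x. f i differentiable (at x)"
    and lip: "\<And>i. l-lipschitz_on UNIV (gradient (f i))"
    and "\<alpha> > 0" and convex: "strongly_convex \<alpha> (average f)"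
    and crit: "gradient (average f) w\<^sub>0 = 0"
    and graph: "connected_graph E" and "\<upsilon> > 0"
  obtains P c where "P \<ge> 1" and "c > 0"
    and "\<And>\<rho> p k w z \<xi>. \<lbrakk>p \<ge> P; 0 < k; k \<le> p; 0 \<le> \<rho>; \<rho> \<le> sqrt \<alpha> - 2 * \<upsilon>; \<rho> \<le> c * (k\<^sup>2 / p);
           distributed_heavy_ball_solution \<alpha> E f p k w z \<xi>\<rbrakk>
         \<Longrightarrow> \<exists>C. \<forall>t\<ge>0. \<forall>i. norm ((w i t, z i t) - (w\<^sub>0, 0)) \<le> C * exp (- (\<rho> / 2) * t)"
proof -
  have sym: "sym E" using graph by (auto simp: connected_graph_def)
  obtain \<mu> where \<mu>: "\<mu> > 0"
    "\<And>x :: ((real^'n) \<times> (real^'n))^'v. \<mu> * (norm (deviation x))\<^sup>2 \<le> laplacian E x \<bullet> x"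
    using laplacian_coercive[OF graph] by blast
  define P1 where "P1 = 5 * (1 + 2 * sqrt \<alpha> + l)\<^sup>2 / (4 * \<mu>) * (real CARD('v) * (2 / \<alpha> + 4)) / \<upsilon>"
  define P2 where "P2 = 4 / \<mu> * (sqrt \<alpha> + l\<^sup>2 / (2 * \<upsilon>) + 5 * (1 + 2 * sqrt \<alpha> + l)\<^sup>2 / (4 * \<mu>))"
  show ?thesis
  proof (rule that[of "max 1 (max P1 P2)" "\<mu> / 16"])
    show "1 \<le> max 1 (max P1 P2)" "0 < \<mu> / 16" using \<mu> by simp_all
    fix \<rho> p k :: real and w z \<xi>
    assume "p \<ge> max 1 (max P1 P2)" and k: "0 < k" "k \<le> p"
      and \<rho>: "0 \<le> \<rho>" "\<rho> \<le> sqrt \<alpha> - 2 * \<upsilon>" "\<rho> \<le> \<mu> / 16 * (k\<^sup>2 / p)"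
      and sol: "distributed_heavy_ball_solution \<alpha> E f p k w z \<xi>"
    then have p: "p \<ge> 1" "p \<ge> P1" "p \<ge> P2" by simp_all
    define x where "x t = (\<chi> i. (w i t, z i t))" for t
    define y where "y t = (\<chi> i. \<xi> i t)" for t
    define x\<^sub>0 :: "((real^'n) \<times> (real^'n))^'v" where "x\<^sub>0 = (\<chi> i. (w\<^sub>0, 0))"
    have "mean (\<chi> i. gradient (f i) w\<^sub>0) = 0"
      using crit gradient_average[of f w\<^sub>0] diff by simp
    then have "mean (stacked_field \<alpha> f x\<^sub>0) = 0"
      by (simp add: mean_stacked_field x\<^sub>0_def zero_prod_def)
    then have "mean ((1 / k) *\<^sub>R stacked_field \<alpha> f x\<^sub>0) = 0"
      by (simp add: linear_cmul[OF linear_mean])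
    then obtain \<eta> where "laplacian E \<eta> = (1 / k) *\<^sub>R stacked_field \<alpha> f x\<^sub>0"
      by (rule laplacian_solvable[OF graph])
    then have \<eta>: "k *\<^sub>R laplacian E \<eta> = stacked_field \<alpha> f (\<chi> i. (w\<^sub>0, 0))"
      using k by (simp add: x\<^sub>0_def)
    define x' where "x' t = stacked_field \<alpha> f (x t) - p *\<^sub>R laplacian E (x t) - k *\<^sub>R laplacian E (y t)" for t
    define e where "e t = deviation (x t)" for t
    define h where "h t = deviation (y t - \<eta>)" for t
    define h' where "h' t = deviation (k *\<^sub>R laplacian E (x t))" for t
    define m where "m t = mean (x t)" for t
    define V where "V t = heavy_ball_energy \<alpha> (average f) w\<^sub>0 (fst (m t)) (snd (m t))" for t
    define V1 where "V1 t = (norm (e t))\<^sup>2 / 2 + (norm (h t))\<^sup>2 / 2 + k / (4 * p) * (e t \<bullet> h t)" for t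
    define W' where "W' t = gradient (average f) (fst (m t)) \<bullet> fst (mean (x' t))
       + (sqrt \<alpha> *\<^sub>R (fst (m t) - w\<^sub>0) + snd (m t)) \<bullet> (sqrt \<alpha> *\<^sub>R fst (mean (x' t)) + snd (mean (x' t)))
       + (e t \<bullet> deviation (x' t) + h t \<bullet> h' t + k / (4 * p) * (deviation (x' t) \<bullet> h t + e t \<bullet> h' t))" for t

    have deriv: "((\<lambda>t. V t + V1 t) has_real_derivative W' t) (at t within {0..})" if "t \<ge> 0" for t
    proof -
      note bl = bounded_linear.has_vector_derivative[OF linear_conv_bounded_linear[THEN iffD1]]
      have dx: "(x has_vector_derivative x' t) (at t within {0..})"
        and dy: "(y has_vector_derivative k *\<^sub>R laplacian E (x t)) (at t within {0..})"
        using distributed_heavy_ball_stacked[OF sol that]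
        by (simp_all add: x_def[abs_def] y_def[abs_def] x'_def)
      have dm: "(m has_vector_derivative mean (x' t)) (at t within {0..})"
        unfolding m_def[abs_def] by (rule bl[OF linear_mean dx])
      have de: "(e has_vector_derivative deviation (x' t)) (at t within {0..})"
        unfolding e_def[abs_def] by (rule bl[OF linear_deviation dx])
      have dh: "(h has_vector_derivative h' t) (at t within {0..})"
        unfolding h_def[abs_def] h'_def
        by (rule bl[OF linear_deviation]) (use has_vector_derivative_diff[OF dy has_vector_derivative_const] in simp)
      have F: "average f differentiable (at (fst (m t)))"
        using convex by (simp add: strongly_convex_def)
      show ?thesis
        unfolding V_def[abs_def] V1_def[abs_def] W'_def
        by (intro DERIV_add has_real_derivative_heavy_ball_energy[where a="\<lambda>t. fst (m t)" and b="\<lambda>t. snd (m t)"]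
            has_real_derivative_disagreement_energy F de dh
            bounded_linear.has_vector_derivative[OF bounded_linear_fst dm]
            bounded_linear.has_vector_derivative[OF bounded_linear_snd dm])
    qed
    have "W' t \<le> - \<rho> * (V t + V1 t)" for t
      unfolding W'_def V_def V1_def m_def e_def h_def h'_def x'_def
      by (rule total_energy_dissipation[OF diff lip \<open>\<alpha> > 0\<close> convex crit sym \<mu> \<open>\<upsilon> > 0\<close> k p[unfolded P1_def P2_def] \<rho>(1,2) _ \<eta>])
         (use \<rho>(3) in \<open>simp add: mult_ac\<close>)
    then have decay: "V t + V1 t \<le> (V 0 + V1 0) * exp (- \<rho> * t)" if "t \<ge> 0" for t
      using exponential_decay[of "\<lambda>t. V t + V1 t" W' \<rho> t] deriv that by blast

    define B where "B = 4 + real CARD('v) * (2 / \<alpha> + 4)"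
    \<comment> \<open>The summand \<open>4\<close> of \<open>B\<close> belongs to the disagreement, the other one to the error of the mean.\<close>
    have dist: "(norm ((w i t, z i t) - (w\<^sub>0, 0)))\<^sup>2 \<le> B * (V t + V1 t)" for i t
    proof -
      have "norm ((w i t, z i t) - (w\<^sub>0, 0)) \<le> norm (x t - x\<^sub>0)"
        using Finite_Cartesian_Product.norm_nth_le[of "x t - x\<^sub>0" i] by (simp add: x_def x\<^sub>0_def)
      then have "(norm ((w i t, z i t) - (w\<^sub>0, 0)))\<^sup>2 \<le> (norm (x t - x\<^sub>0))\<^sup>2"
        by (rule power_mono) simp
      also have "\<dots> = (norm (e t))\<^sup>2 + real CARD('v) * (norm (m t - (w\<^sub>0, 0)))\<^sup>2"
        by (simp add: x\<^sub>0_def norm_sq_deviation_mean e_def m_def)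
      also have "(norm (m t - (w\<^sub>0, 0)))\<^sup>2 = (norm (fst (m t) - w\<^sub>0))\<^sup>2 + (norm (snd (m t)))\<^sup>2"
        by (cases "m t") (simp add: norm_prod_def)
      finally have 1: "(norm ((w i t, z i t) - (w\<^sub>0, 0)))\<^sup>2
          \<le> (norm (e t))\<^sup>2 + real CARD('v) * ((norm (fst (m t) - w\<^sub>0))\<^sup>2 + (norm (snd (m t)))\<^sup>2)" .
      have V: "(norm (fst (m t) - w\<^sub>0))\<^sup>2 + (norm (snd (m t)))\<^sup>2 \<le> (2 / \<alpha> + 4) * V t"
        unfolding V_def by (rule heavy_ball_energy_coercive[OF convex \<open>\<alpha> > 0\<close> crit])
      have "V t \<ge> 0"
      proof -
        have "0 \<le> (2 / \<alpha> + 4) * V t" by (rule order_trans[OF _ V]) simp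
        moreover have "2 / \<alpha> + 4 > 0" using \<open>\<alpha> > 0\<close> by (simp add: add_pos_pos)
        ultimately show ?thesis by (simp add: zero_le_mult_iff)
      qed
      have V1: "((norm (e t))\<^sup>2 + (norm (h t))\<^sup>2) / 4 \<le> V1 t"
        unfolding V1_def using k by (intro disagreement_energy_bounds) (auto simp: field_simps)
      have "V1 t \<ge> 0" by (rule order_trans[OF _ V1]) simp
      moreover have "(norm (e t))\<^sup>2 \<le> 4 * V1 t"
        using V1 zero_le_power2[of "norm (h t)"] by argo
      moreover have "real CARD('v) * ((norm (fst (m t) - w\<^sub>0))\<^sup>2 + (norm (snd (m t)))\<^sup>2)
          \<le> (B - 4) * V t"
        using mult_left_mono[OF V, of "real CARD('v)"] by (simp add: B_def mult.assoc)
      moreover have "0 \<le> (B - 4) * V1 t"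
        using \<open>V1 t \<ge> 0\<close> \<open>\<alpha> > 0\<close> by (simp add: B_def)
      ultimately show ?thesis
        using 1 \<open>V t \<ge> 0\<close> by (simp add: algebra_simps)
    qed
    show "\<exists>C. \<forall>t\<ge>0. \<forall>i. norm ((w i t, z i t) - (w\<^sub>0, 0)) \<le> C * exp (- (\<rho> / 2) * t)"
    proof (intro exI[of _ "sqrt (B * (V 0 + V1 0))"] allI impI)
      fix t :: real and i assume "t \<ge> 0"
      have B: "B \<ge> 0" using \<open>\<alpha> > 0\<close> by (simp add: B_def)
      have "(norm ((w i t, z i t) - (w\<^sub>0, 0)))\<^sup>2 \<le> B * (V 0 + V1 0) * exp (- \<rho> * t)"
        using order_trans[OF dist mult_left_mono[OF decay[OF \<open>t \<ge> 0\<close>] B]] by (simp add: mult.assoc)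
      also have "exp (- \<rho> * t) = (exp (- (\<rho> / 2) * t))\<^sup>2"
        by (simp flip: exp_double)
      finally have "norm ((w i t, z i t) - (w\<^sub>0, 0)) \<le> sqrt (B * (V 0 + V1 0) * (exp (- (\<rho> / 2) * t))\<^sup>2)"
        by (rule real_le_rsqrt)
      then show "norm ((w i t, z i t) - (w\<^sub>0, 0)) \<le> sqrt (B * (V 0 + V1 0)) * exp (- (\<rho> / 2) * t)"
        by (simp add: real_sqrt_mult)
    qed
  qed
qed

theorem theorem3:
  fixes f :: "'v::finite \<Rightarrow> real^'n \<Rightarrow> real"
    and E :: "('v \<times> 'v) set"
    and \<alpha> :: real
    and w_star :: "real^'n"
  assumes "\<And>i. continuously_differentiable (f i)"
    and "\<And>i. \<exists>L. L-lipschitz_on UNIV (gradient (f i))"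
    and "\<alpha> > 0"
    and "strongly_convex \<alpha> (average f)"
    and "is_arg_min (average f) (\<lambda>_. True) w_star"
    and "connected_graph E"
  shows "(\<forall>p. heavy_ball_field \<alpha> (average f) p = 0 \<longleftrightarrow> p = (w_star, 0)) \<and>
    (\<forall>kI>0. \<exists>K. \<forall>kP>K. \<forall>w z \<xi>.
        distributed_heavy_ball_solution \<alpha> E f kP kI w z \<xi> \<longrightarrow>
        (\<forall>i. (w i \<longlongrightarrow> w_star) at_top \<and> (z i \<longlongrightarrow> 0) at_top)) \<and>
    (\<forall>\<upsilon>. 0 < \<upsilon> \<and> \<upsilon> < sqrt \<alpha> / 2 \<longrightarrow>
        (\<exists>kbar>0. \<forall>kI>kbar. \<forall>w z \<xi>.
           distributed_heavy_ball_solution \<alpha> E f (kI powr (3/2)) kI w z \<xi> \<longrightarrow>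
           (\<forall>i. converges_exponentially (\<lambda>t. (w i t, z i t)) (w_star, 0) (sqrt \<alpha> / 2 - \<upsilon>))))"
proof -
  have diff: "f i differentiable (at x)" for i x
    using assms(1) by (simp add: continuously_differentiable_def)
  obtain L where L: "\<And>i. (L i)-lipschitz_on UNIV (gradient (f i))"
    using assms(2) by metis
  define l where "l = (\<Sum>i\<in>UNIV. L i)"
  have lip: "l-lipschitz_on UNIV (gradient (f i))" for i
  proof (rule lipschitz_on_le[OF L])
    show "L i \<le> l"
      unfolding l_def by (rule member_le_sum) (auto intro: lipschitz_on_nonneg[OF L])
  qed
  have crit: "gradient (average f) w_star = 0"
    by (rule minimizer_imp_gradient_zero)
       (use assms(4,5) in \<open>auto simp: strongly_convex_def is_arg_min_linorder\<close>)
  note decay = distributed_heavy_ball_decay[OF diff lip assms(3,4) crit assms(6)]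

  have equilibrium: "heavy_ball_field \<alpha> (average f) p = 0 \<longleftrightarrow> p = (w_star, 0)" for p
  proof -
    have "a = w_star" if "gradient (average f) a = 0" for a
    proof -
      have "\<alpha> * (norm (a - w_star))\<^sup>2 \<le> 0"
        using assms(4) that crit unfolding strongly_convex_def by (metis diff_self inner_zero_left)
      then show ?thesis using assms(3) by (simp add: mult_le_0_iff)
    qed
    then show ?thesis
      by (cases p) (auto simp: heavy_ball_field_def zero_prod_def crit)
  qed

  have convergence: "\<exists>K. \<forall>kP>K. \<forall>w z \<xi>.
        distributed_heavy_ball_solution \<alpha> E f kP kI w z \<xi> \<longrightarrow>
        (\<forall>i. (w i \<longlongrightarrow> w_star) at_top \<and> (z i \<longlongrightarrow> 0) at_top)" if "kI > 0" for kI
  proof -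
    have s: "sqrt \<alpha> / 4 > 0" using assms(3) by simp
    obtain P c where P: "P \<ge> 1" and c: "c > 0" and
      decay': "\<And>\<rho> p k w z \<xi>. \<lbrakk>p \<ge> P; 0 < k; k \<le> p; 0 \<le> \<rho>; \<rho> \<le> sqrt \<alpha> - 2 * (sqrt \<alpha> / 4); \<rho> \<le> c * (k\<^sup>2 / p);
           distributed_heavy_ball_solution \<alpha> E f p k w z \<xi>\<rbrakk>
         \<Longrightarrow> \<exists>C. \<forall>t\<ge>0. \<forall>i. norm ((w i t, z i t) - (w_star, 0)) \<le> C * exp (- (\<rho> / 2) * t)"
      by (rule decay[OF s]) blast
    show ?thesis
    proof (intro exI[of _ "max P kI"] allI impI)
      fix kP w z \<xi> i
      assume kP: "max P kI < kP" and sol: "distributed_heavy_ball_solution \<alpha> E f kP kI w z \<xi>"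
      \<comment> \<open>This rate degenerates as \<open>kP\<close> grows with \<open>kI\<close> fixed, since the integral states \<open>\<xi>\<close>
        then adapt slowly; positivity is all that matters here.\<close>
      define \<rho> where "\<rho> = min (sqrt \<alpha> / 2) (c * (kI\<^sup>2 / kP))"
      have \<rho>: "\<rho> > 0" using assms(3) c that kP P by (simp add: \<rho>_def)
      have "\<exists>C. \<forall>t\<ge>0. \<forall>i. norm ((w i t, z i t) - (w_star, 0)) \<le> C * exp (- (\<rho> / 2) * t)"
        by (rule decay'[OF _ _ _ _ _ _ sol]) (use kP that \<rho> in \<open>auto simp: \<rho>_def min_def\<close>)
      then obtain C where C: "\<And>t. t \<ge> 0 \<Longrightarrow> norm ((w i t, z i t) - (w_star, 0)) \<le> C * exp (- (\<rho> / 2) * t)"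
        by blast
      have "((\<lambda>t. C * exp (- (\<rho> / 2) * t)) \<longlongrightarrow> C * 0) at_top"
      proof (intro tendsto_mult tendsto_const filterlim_compose[OF exp_at_bot])
        show "filterlim (\<lambda>t. - (\<rho> / 2) * t) at_bot at_top"
          using \<rho> by (intro filterlim_tendsto_neg_mult_at_bot[OF tendsto_const _ filterlim_ident]) simp
      qed
      then have bound: "((\<lambda>t. C * exp (- (\<rho> / 2) * t)) \<longlongrightarrow> 0) at_top" by simp
      have "((\<lambda>t. (w i t, z i t) - (w_star, 0)) \<longlongrightarrow> 0) at_top"
        by (rule Lim_null_comparison[OF _ bound], rule eventually_at_top_linorderI[of 0], rule C)
      then have lim: "((\<lambda>t. (w i t, z i t)) \<longlongrightarrow> (w_star, 0)) at_top"
        by (rule LIM_zero_cancel)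
      show "(w i \<longlongrightarrow> w_star) at_top \<and> (z i \<longlongrightarrow> 0) at_top"
        using tendsto_fst[OF lim] tendsto_snd[OF lim] by simp
    qed
  qed

  have rate: "\<exists>kbar>0. \<forall>kI>kbar. \<forall>w z \<xi>.
           distributed_heavy_ball_solution \<alpha> E f (kI powr (3/2)) kI w z \<xi> \<longrightarrow>
           (\<forall>i. converges_exponentially (\<lambda>t. (w i t, z i t)) (w_star, 0) (sqrt \<alpha> / 2 - \<upsilon>))"
    if \<upsilon>: "0 < \<upsilon>" "\<upsilon> < sqrt \<alpha> / 2" for \<upsilon>
  proof -
    obtain P c where P: "P \<ge> 1" and c: "c > 0" and
      decay': "\<And>\<rho> p k w z \<xi>. \<lbrakk>p \<ge> P; 0 < k; k \<le> p; 0 \<le> \<rho>; \<rho> \<le> sqrt \<alpha> - 2 * \<upsilon>; \<rho> \<le> c * (k\<^sup>2 / p);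
           distributed_heavy_ball_solution \<alpha> E f p k w z \<xi>\<rbrakk>
         \<Longrightarrow> \<exists>C. \<forall>t\<ge>0. \<forall>i. norm ((w i t, z i t) - (w_star, 0)) \<le> C * exp (- (\<rho> / 2) * t)"
      by (rule decay[OF \<upsilon>(1)]) blast
    define \<rho> where "\<rho> = sqrt \<alpha> - 2 * \<upsilon>"
    have \<rho>: "\<rho> > 0" using \<upsilon> by (simp add: \<rho>_def)
    \<comment> \<open>The second entry makes \<open>c * sqrt kI\<close>, the rate limit set by \<open>\<xi>\<close>, exceed \<open>\<rho>\<close>.\<close>
    define kbar where "kbar = max P ((\<rho> / c)\<^sup>2)"
    show ?thesis
    proof (intro exI[of _ kbar] conjI allI impI)
      show "0 < kbar" using P by (simp add: kbar_def)
      fix kI w z \<xi> i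
      assume "kbar < kI" and sol: "distributed_heavy_ball_solution \<alpha> E f (kI powr (3/2)) kI w z \<xi>"
      then have kI: "kI > P" "kI > 1" "kI > (\<rho> / c)\<^sup>2" using P by (auto simp: kbar_def)
      have kP: "kI \<le> kI powr (3/2)"
        using powr_mono[of 1 "3/2" kI] kI by simp
      have "kI\<^sup>2 / kI powr (3/2) = sqrt kI"
      proof -
        have "kI\<^sup>2 / kI powr (3/2) = kI powr (2 - 3/2)"
          using kI by (subst powr_diff) simp
        then show ?thesis using kI by (simp add: powr_half_sqrt)
      qed
      moreover have "\<rho> / c \<le> sqrt kI"
        using kI(3) by (intro real_le_rsqrt) simp
      ultimately have "\<rho> \<le> c * (kI\<^sup>2 / kI powr (3/2))"
        using c by (simp add: field_simps)
      then have "\<exists>C. \<forall>t\<ge>0. \<forall>i. norm ((w i t, z i t) - (w_star, 0)) \<le> C * exp (- (\<rho> / 2) * t)"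
        by (intro decay'[OF _ _ _ _ _ _ sol]) (use kI kP \<rho> in \<open>auto simp: \<rho>_def\<close>)
      moreover have "\<rho> / 2 = sqrt \<alpha> / 2 - \<upsilon>" by (simp add: \<rho>_def field_simps)
      ultimately show "converges_exponentially (\<lambda>t. (w i t, z i t)) (w_star, 0) (sqrt \<alpha> / 2 - \<upsilon>)"
        unfolding converges_exponentially_def using \<upsilon> by auto
    qed
  qed
  from equilibrium convergence rate show ?thesis by blast
qed

end
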